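(* Let $\mathcal{B}$ be a bicategory with finite coproducts, and let $\mathcal{L},\mathcal{R}\colon\mathcal{B}^{\mathrm{op}}\to\mathbf{Cat}$ be $\mathcal{B}$-indexed categories that turn finite coproducts in $\mathcal{B}$ into finite products in $\mathbf{Cat}$. Then the category $\mathbf{Optic}_{\mathcal{L},\mathcal{R}}$ of dependent optics has finite coproducts.
   Context: For a bicategory $\mathcal{B}$, $\mathcal{B}(A,B)$ denotes the category of 1-morphisms $A\to B$ and 2-morphisms; $\mathcal{B}^{\mathrm{op}}$ reverses 1-morphisms only. Coproducts in $\mathcal{B}$ and products in $\mathbf{Cat}$ are meant in the bicategorical sense: $A$ with 1-morphisms $\iota_i\colon A_i\to A$ is a coproduct of $(A_i)_{i\in I}$ if for every $B$ the functor $\mathcal{B}(A,B)\to\prod_i\mathcal{B}(A_i,B)$, $f\mapsto (f\circ\iota_i)_i$, is an equivalence of categories; and $\mathcal{L}$ (resp. $\mathcal{R}$) turns finite coproducts into finite products if for every finite coproduct $A=\coprod_{i\in I}A_i$ in $\mathcal{B}$ the functor $\mathcal{L}(A)\to\prod_{i\in I}\mathcal{L}(A_i)$ (resp. $\mathcal{R}(A)\to\prod_{i\in I}\mathcal{R}(A_i)$) induced by the $\iota_i$ is an equivalence of categories. A $\mathcal{B}$-indexed category is a pseudofunctor $\mathcal{B}^{\mathrm{op}}\to\mathbf{Cat}$. Write $\mathcal{L}^A=\mathcal{L}(A)$, $\mathcal{R}^A=\mathcal{R}(A)$, $f^*=\mathcal{L}(f)$, $f^{*'}=\mathcal{R}(f)$;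 the coherence isomorphisms of $\mathcal{L}$ are $\theta_A\colon\mathrm{Id}_{\mathcal{L}^A}\Rightarrow \mathrm{Id}_A^*$, $\theta_{f,g}\colon f^*\circ g^*\Rightarrow (g\circ f)^*$, and analogously $\theta'$ for $\mathcal{R}$. The category $\mathbf{Optic}_{\mathcal{L},\mathcal{R}}$ of dependent optics has objects $(X,X')^A$ with $A\in\mathrm{Ob}(\mathcal{B})$, $X\in\mathrm{Ob}(\mathcal{L}^A)$, $X'\in\mathrm{Ob}(\mathcal{R}^A)$, and morphisms $$\mathbf{Optic}_{\mathcal{L},\mathcal{R}}\big((X,X')^A,(Y,Y')^B\big)=\int^{f\in\mathcal{B}(A,B)}\mathcal{L}^A(X,f^*Y)\times\mathcal{R}^A(f^{*'}Y',X')$$ (these coends in $\mathbf{Set}$ are assumed to exist). The class of $(l,r)$, $l\colon X\to f^*Y$, $r\colon f^{*'}Y'\to X'$, is denoted $\langle l|r\rangle$ and $f$ is its representative. Identities are $\langle(\theta_A)_X|(\theta_A'^{-1})_{X'}\rangle$ (representative $\mathrm{Id}_A$) and composition is $\langle l_2|r_2\rangle\circ\langle l_1|r_1\rangle=\langle(\theta_{f,g})_Z\circ f^*(l_2)\circ l_1\,|\,r_1\circ f^{*'}(r_2)\circ(\theta'^{-1}_{f,g})_{Z'}\rangle$ (representative $g\circ f$), where $f$ and $g$ are representatives of $\langle l_1|r_1\rangle$ and $\langle l_2|r_2\rangle$. *)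

theory Defs
  imports Main "HOL-Library.FuncSet"
begin

section \<open>Categories\<close>

text \<open>
  Hom-sets are pairwise disjoint: every arrow carries its domain and codomain. Operations are only
  constrained on the carriers \<open>Ob\<close> and \<open>Ar\<close>.
\<close>

record ('x, 'm) cat =
  Ob :: "'x set"
  Ar :: "'m set"
  Dom :: "'m \<Rightarrow> 'x"
  Cod :: "'m \<Rightarrow> 'x"
  Idt :: "'x \<Rightarrow> 'm"
  Cmp :: "'m \<Rightarrow> 'm \<Rightarrow> 'm" (infixl "\<cdot>\<index>" 70)

definition hom :: "('x, 'm) cat \<Rightarrow> 'x \<Rightarrow> 'x \<Rightarrow> 'm set" where
  "hom C a b = {f \<in> Ar C. Dom C f = a \<and> Cod C f = b}"

locale category =
  fixes C :: "('x, 'm) cat" (structure)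
  assumes dom_closed: "f \<in> Ar C \<Longrightarrow> Dom C f \<in> Ob C"
    and cod_closed: "f \<in> Ar C \<Longrightarrow> Cod C f \<in> Ob C"
    and id_hom: "a \<in> Ob C \<Longrightarrow> Idt C a \<in> hom C a a"
    and comp_hom: "\<lbrakk>f \<in> hom C a b; g \<in> hom C b c\<rbrakk> \<Longrightarrow> g \<cdot> f \<in> hom C a c"
    and id_left: "f \<in> hom C a b \<Longrightarrow> Idt C b \<cdot> f = f"
    and id_right: "f \<in> hom C a b \<Longrightarrow> f \<cdot> Idt C a = f"
    and assoc: "\<lbrakk>f \<in> hom C a b; g \<in> hom C b c; h \<in> hom C c d\<rbrakk> \<Longrightarrow> (h \<cdot> g) \<cdot> f = h \<cdot> (g \<cdot> f)"

definition is_inverse :: "('x, 'm) cat \<Rightarrow> 'm \<Rightarrow> 'm \<Rightarrow> bool" where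
  "is_inverse C f g \<longleftrightarrow> f \<in> Ar C \<and> g \<in> hom C (Cod C f) (Dom C f) \<and>
     g \<cdot>\<^bsub>C\<^esub> f = Idt C (Dom C f) \<and> f \<cdot>\<^bsub>C\<^esub> g = Idt C (Cod C f)"

definition is_iso :: "('x, 'm) cat \<Rightarrow> 'm \<Rightarrow> bool" where
  "is_iso C f \<longleftrightarrow> (\<exists>g. is_inverse C f g)"

definition inv_ar :: "('x, 'm) cat \<Rightarrow> 'm \<Rightarrow> 'm" where
  "inv_ar C f = (THE g. is_inverse C f g)"

definition prod_cat :: "'i set \<Rightarrow> ('i \<Rightarrow> ('x, 'm) cat) \<Rightarrow> ('i \<Rightarrow> 'x, 'i \<Rightarrow> 'm) cat" where
  "prod_cat I C =
     \<lparr>Ob = (\<Pi>\<^sub>E i\<in>I. Ob (C i)),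
      Ar = (\<Pi>\<^sub>E i\<in>I. Ar (C i)),
      Dom = (\<lambda>f. \<lambda>i\<in>I. Dom (C i) (f i)),
      Cod = (\<lambda>f. \<lambda>i\<in>I. Cod (C i) (f i)),
      Idt = (\<lambda>x. \<lambda>i\<in>I. Idt (C i) (x i)),
      Cmp = (\<lambda>g f. \<lambda>i\<in>I. g i \<cdot>\<^bsub>C i\<^esub> f i)\<rparr>"

section \<open>Functors, natural transformations, equivalences\<close>

record ('x, 'm, 'y, 'n) fnct =
  fob :: "'x \<Rightarrow> 'y"
  far :: "'m \<Rightarrow> 'n"

definition is_functor :: "('x, 'm) cat \<Rightarrow> ('y, 'n) cat \<Rightarrow> ('x, 'm, 'y, 'n) fnct \<Rightarrow> bool" where
  "is_functor C D F \<longleftrightarrow>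
     (\<forall>x\<in>Ob C. fob F x \<in> Ob D) \<and>
     (\<forall>x y f. f \<in> hom C x y \<longrightarrow> far F f \<in> hom D (fob F x) (fob F y)) \<and>
     (\<forall>x\<in>Ob C. far F (Idt C x) = Idt D (fob F x)) \<and>
     (\<forall>x y z f g. f \<in> hom C x y \<longrightarrow> g \<in> hom C y z \<longrightarrow>
        far F (g \<cdot>\<^bsub>C\<^esub> f) = far F g \<cdot>\<^bsub>D\<^esub> far F f)"

definition id_fnct :: "('x, 'm, 'x, 'm) fnct" where
  "id_fnct = \<lparr>fob = (\<lambda>x. x), far = (\<lambda>f. f)\<rparr>"

definition comp_fnct ::
  "('y, 'n, 'z, 'k) fnct \<Rightarrow> ('x, 'm, 'y, 'n) fnct \<Rightarrow> ('x, 'm, 'z, 'k) fnct" where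
  "comp_fnct G F = \<lparr>fob = (\<lambda>x. fob G (fob F x)), far = (\<lambda>f. far G (far F f))\<rparr>"

definition nat_trans :: "('x, 'm) cat \<Rightarrow> ('y, 'n) cat \<Rightarrow> ('x, 'm, 'y, 'n) fnct \<Rightarrow>
    ('x, 'm, 'y, 'n) fnct \<Rightarrow> ('x \<Rightarrow> 'n) \<Rightarrow> bool" where
  "nat_trans C D F G \<eta> \<longleftrightarrow>
     (\<forall>x\<in>Ob C. \<eta> x \<in> hom D (fob F x) (fob G x)) \<and>
     (\<forall>x y f. f \<in> hom C x y \<longrightarrow> \<eta> y \<cdot>\<^bsub>D\<^esub> far F f = far G f \<cdot>\<^bsub>D\<^esub> \<eta> x)"

definition nat_iso :: "('x, 'm) cat \<Rightarrow> ('y, 'n) cat \<Rightarrow> ('x, 'm, 'y, 'n) fnct \<Rightarrow>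
    ('x, 'm, 'y, 'n) fnct \<Rightarrow> ('x \<Rightarrow> 'n) \<Rightarrow> bool" where
  "nat_iso C D F G \<eta> \<longleftrightarrow> nat_trans C D F G \<eta> \<and> (\<forall>x\<in>Ob C. is_iso D (\<eta> x))"

definition is_equivalence :: "('x, 'm) cat \<Rightarrow> ('y, 'n) cat \<Rightarrow> ('x, 'm, 'y, 'n) fnct \<Rightarrow> bool" where
  "is_equivalence C D F \<longleftrightarrow> is_functor C D F \<and>
     (\<exists>G \<eta> \<epsilon>. is_functor D C G \<and> nat_iso C C id_fnct (comp_fnct G F) \<eta> \<and>
        nat_iso D D (comp_fnct F G) id_fnct \<epsilon>)"

section \<open>Coproducts in a category\<close>

definition is_coproduct ::
  "('x, 'm) cat \<Rightarrow> 'i set \<Rightarrow> ('i \<Rightarrow> 'x) \<Rightarrow> 'x \<Rightarrow> ('i \<Rightarrow> 'm) \<Rightarrow> bool" where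
  "is_coproduct C I X c \<iota> \<longleftrightarrow>
     c \<in> Ob C \<and> (\<forall>i\<in>I. \<iota> i \<in> hom C (X i) c) \<and>
     (\<forall>d\<in>Ob C. \<forall>f. (\<forall>i\<in>I. f i \<in> hom C (X i) d) \<longrightarrow>
        (\<exists>!h. h \<in> hom C c d \<and> (\<forall>i\<in>I. h \<cdot>\<^bsub>C\<^esub> \<iota> i = f i)))"

text \<open>
  Finite families are indexed by finite sets of natural numbers; the empty set gives initial
  objects.
\<close>

definition has_finite_coproducts :: "('x, 'm) cat \<Rightarrow> bool" where
  "has_finite_coproducts C \<longleftrightarrow>
     (\<forall>(I :: nat set) X. finite I \<longrightarrow> (\<forall>i\<in>I. X i \<in> Ob C) \<longrightarrow> (\<exists>c \<iota>. is_coproduct C I X c \<iota>))"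

section \<open>Bicategories\<close>

text \<open>
  1-cells carry their source and target, 2-cells their (parallel) domain and codomain 1-cells.
  \<open>Hcmp1 B g f\<close> and \<open>Hcmp2 B \<beta> \<alpha>\<close> are \<open>g \<circ> f\<close> and the horizontal
  composite \<open>\<beta> * \<alpha>\<close>.
\<close>

record ('o, 'f, 't) bicat =
  Ob0 :: "'o set"
  Ar1 :: "'f set"
  Src :: "'f \<Rightarrow> 'o"
  Tgt :: "'f \<Rightarrow> 'o"
  Ar2 :: "'t set"
  Dom2 :: "'t \<Rightarrow> 'f"
  Cod2 :: "'t \<Rightarrow> 'f"
  Id2 :: "'f \<Rightarrow> 't"
  Vcmp :: "'t \<Rightarrow> 't \<Rightarrow> 't"
  Id1 :: "'o \<Rightarrow> 'f"
  Hcmp1 :: "'f \<Rightarrow> 'f \<Rightarrow> 'f"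
  Hcmp2 :: "'t \<Rightarrow> 't \<Rightarrow> 't"
  Asc :: "'f \<Rightarrow> 'f \<Rightarrow> 'f \<Rightarrow> 't"
  Lun :: "'f \<Rightarrow> 't"
  Run :: "'f \<Rightarrow> 't"

definition homcat :: "('o, 'f, 't) bicat \<Rightarrow> 'o \<Rightarrow> 'o \<Rightarrow> ('f, 't) cat" where
  "homcat B a b =
     \<lparr>Ob = {f \<in> Ar1 B. Src B f = a \<and> Tgt B f = b},
      Ar = {\<alpha> \<in> Ar2 B. Src B (Dom2 B \<alpha>) = a \<and> Tgt B (Dom2 B \<alpha>) = b},
      Dom = Dom2 B, Cod = Cod2 B, Idt = Id2 B, Cmp = Vcmp B\<rparr>"

locale bicategory =
  fixes B :: "('o, 'f, 't) bicat"
  assumes src_closed: "f \<in> Ar1 B \<Longrightarrow> Src B f \<in> Ob0 B"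
    and tgt_closed: "f \<in> Ar1 B \<Longrightarrow> Tgt B f \<in> Ob0 B"
    and dom2_closed: "\<alpha> \<in> Ar2 B \<Longrightarrow> Dom2 B \<alpha> \<in> Ar1 B"
    and homcat_category: "\<lbrakk>a \<in> Ob0 B; b \<in> Ob0 B\<rbrakk> \<Longrightarrow> category (homcat B a b)"
    and id1: "a \<in> Ob0 B \<Longrightarrow> Id1 B a \<in> Ob (homcat B a a)"
    and hcmp1: "\<lbrakk>f \<in> Ob (homcat B a b); g \<in> Ob (homcat B b c)\<rbrakk>
        \<Longrightarrow> Hcmp1 B g f \<in> Ob (homcat B a c)"
    and hcmp2: "\<lbrakk>\<alpha> \<in> hom (homcat B a b) f f'; \<beta> \<in> hom (homcat B b c) g g'\<rbrakk>
        \<Longrightarrow> Hcmp2 B \<beta> \<alpha> \<in> hom (homcat B a c) (Hcmp1 B g f) (Hcmp1 B g' f')"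
    and hcmp2_id: "\<lbrakk>f \<in> Ob (homcat B a b); g \<in> Ob (homcat B b c)\<rbrakk>
        \<Longrightarrow> Hcmp2 B (Id2 B g) (Id2 B f) = Id2 B (Hcmp1 B g f)"
    and interchange: "\<lbrakk>\<alpha> \<in> hom (homcat B a b) f f'; \<alpha>' \<in> hom (homcat B a b) f' f'';
          \<beta> \<in> hom (homcat B b c) g g'; \<beta>' \<in> hom (homcat B b c) g' g''\<rbrakk>
        \<Longrightarrow> Hcmp2 B (Vcmp B \<beta>' \<beta>) (Vcmp B \<alpha>' \<alpha>) = Vcmp B (Hcmp2 B \<beta>' \<alpha>') (Hcmp2 B \<beta> \<alpha>)"
    and asc: "\<lbrakk>f \<in> Ob (homcat B a b); g \<in> Ob (homcat B b c); h \<in> Ob (homcat B c d)\<rbrakk>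
        \<Longrightarrow> Asc B h g f \<in> hom (homcat B a d) (Hcmp1 B (Hcmp1 B h g) f) (Hcmp1 B h (Hcmp1 B g f))
           \<and> is_iso (homcat B a d) (Asc B h g f)"
    and asc_natural: "\<lbrakk>\<alpha> \<in> hom (homcat B a b) f f'; \<beta> \<in> hom (homcat B b c) g g';
          \<gamma> \<in> hom (homcat B c d) h h'\<rbrakk>
        \<Longrightarrow> Vcmp B (Asc B h' g' f') (Hcmp2 B (Hcmp2 B \<gamma> \<beta>) \<alpha>) =
            Vcmp B (Hcmp2 B \<gamma> (Hcmp2 B \<beta> \<alpha>)) (Asc B h g f)"
    and lun: "f \<in> Ob (homcat B a b)
        \<Longrightarrow> Lun B f \<in> hom (homcat B a b) (Hcmp1 B (Id1 B b) f) f \<and> is_iso (homcat B a b) (Lun B f)"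
    and lun_natural: "\<alpha> \<in> hom (homcat B a b) f f'
        \<Longrightarrow> Vcmp B (Lun B f') (Hcmp2 B (Id2 B (Id1 B b)) \<alpha>) = Vcmp B \<alpha> (Lun B f)"
    and run: "f \<in> Ob (homcat B a b)
        \<Longrightarrow> Run B f \<in> hom (homcat B a b) (Hcmp1 B f (Id1 B a)) f \<and> is_iso (homcat B a b) (Run B f)"
    and run_natural: "\<alpha> \<in> hom (homcat B a b) f f'
        \<Longrightarrow> Vcmp B (Run B f') (Hcmp2 B \<alpha> (Id2 B (Id1 B a))) = Vcmp B \<alpha> (Run B f)"
    and pentagon: "\<lbrakk>f \<in> Ob (homcat B a b); g \<in> Ob (homcat B b c);
          h \<in> Ob (homcat B c d); k \<in> Ob (homcat B d e)\<rbrakk>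
        \<Longrightarrow> Vcmp B (Asc B k h (Hcmp1 B g f)) (Asc B (Hcmp1 B k h) g f) =
            Vcmp B (Hcmp2 B (Id2 B k) (Asc B h g f))
              (Vcmp B (Asc B k (Hcmp1 B h g) f) (Hcmp2 B (Asc B k h g) (Id2 B f)))"
    and triangle: "\<lbrakk>f \<in> Ob (homcat B a b); g \<in> Ob (homcat B b c)\<rbrakk>
        \<Longrightarrow> Vcmp B (Hcmp2 B (Id2 B g) (Lun B f)) (Asc B g (Id1 B b) f) =
            Hcmp2 B (Run B g) (Id2 B f)"

definition precomp :: "('o, 'f, 't) bicat \<Rightarrow> 'i set \<Rightarrow> ('i \<Rightarrow> 'f) \<Rightarrow>
    ('f, 't, 'i \<Rightarrow> 'f, 'i \<Rightarrow> 't) fnct" where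
  "precomp B I \<iota> =
     \<lparr>fob = (\<lambda>f. \<lambda>i\<in>I. Hcmp1 B f (\<iota> i)), far = (\<lambda>\<alpha>. \<lambda>i\<in>I. Hcmp2 B \<alpha> (Id2 B (\<iota> i)))\<rparr>"

definition is_bicoproduct ::
  "('o, 'f, 't) bicat \<Rightarrow> 'i set \<Rightarrow> ('i \<Rightarrow> 'o) \<Rightarrow> 'o \<Rightarrow> ('i \<Rightarrow> 'f) \<Rightarrow> bool" where
  "is_bicoproduct B I A c \<iota> \<longleftrightarrow>
     (\<forall>i\<in>I. A i \<in> Ob0 B) \<and> c \<in> Ob0 B \<and> (\<forall>i\<in>I. \<iota> i \<in> Ob (homcat B (A i) c)) \<and>
     (\<forall>d\<in>Ob0 B. is_equivalence (homcat B c d) (prod_cat I (\<lambda>i. homcat B (A i) d)) (precomp B I \<iota>))"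

definition has_finite_bicoproducts :: "('o, 'f, 't) bicat \<Rightarrow> bool" where
  "has_finite_bicoproducts B \<longleftrightarrow>
     (\<forall>(I :: nat set) A. finite I \<longrightarrow> (\<forall>i\<in>I. A i \<in> Ob0 B) \<longrightarrow> (\<exists>c \<iota>. is_bicoproduct B I A c \<iota>))"

section \<open>Indexed categories\<close>

text \<open>
  The data of a pseudofunctor from \<open>B\<^sup>o\<^sup>p\<close> (1-cells reversed) to \<open>Cat\<close>:
  \<open>Fib L a\<close> is the value at an object, \<open>Pull L f\<close> the functor \<open>f\<^sup>*\<close>,
  \<open>Pull2 L \<alpha>\<close> the components of the transformation \<open>f\<^sup>* \<Rightarrow> g\<^sup>*\<close> of
  \<open>\<alpha> : f \<Rightarrow> g\<close>; \<open>ThI L a\<close> and \<open>ThC L f g\<close> are the components of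
  \<open>\<theta>\<^sub>a : Id \<Rightarrow> (Id\<^sub>a)\<^sup>*\<close> and \<open>\<theta>\<^sub>f\<^sub>,\<^sub>g : f\<^sup>* \<circ> g\<^sup>* \<Rightarrow> (g \<circ> f)\<^sup>*\<close>.
\<close>

record ('o, 'f, 't, 'x, 'm) icat =
  Fib :: "'o \<Rightarrow> ('x, 'm) cat"
  Pull :: "'f \<Rightarrow> ('x, 'm, 'x, 'm) fnct"
  Pull2 :: "'t \<Rightarrow> 'x \<Rightarrow> 'm"
  ThI :: "'o \<Rightarrow> 'x \<Rightarrow> 'm"
  ThC :: "'f \<Rightarrow> 'f \<Rightarrow> 'x \<Rightarrow> 'm"

locale indexed_category = bicategory B
  for B :: "('o, 'f, 't) bicat" +
  fixes L :: "('o, 'f, 't, 'x, 'm) icat"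
  assumes fib: "a \<in> Ob0 B \<Longrightarrow> category (Fib L a)"
    and pull: "f \<in> Ob (homcat B a b) \<Longrightarrow> is_functor (Fib L b) (Fib L a) (Pull L f)"
    and pull2: "\<alpha> \<in> hom (homcat B a b) f g
        \<Longrightarrow> nat_trans (Fib L b) (Fib L a) (Pull L f) (Pull L g) (Pull2 L \<alpha>)"
    and pull2_id: "\<lbrakk>f \<in> Ob (homcat B a b); Y \<in> Ob (Fib L b)\<rbrakk>
        \<Longrightarrow> Pull2 L (Id2 B f) Y = Idt (Fib L a) (fob (Pull L f) Y)"
    and pull2_vcmp: "\<lbrakk>\<alpha> \<in> hom (homcat B a b) f g; \<beta> \<in> hom (homcat B a b) g h; Y \<in> Ob (Fib L b)\<rbrakk>
        \<Longrightarrow> Pull2 L (Vcmp B \<beta> \<alpha>) Y = Pull2 L \<beta> Y \<cdot>\<^bsub>Fib L a\<^esub> Pull2 L \<alpha> Y"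
    and thI: "a \<in> Ob0 B
        \<Longrightarrow> nat_iso (Fib L a) (Fib L a) id_fnct (Pull L (Id1 B a)) (ThI L a)"
    and thC: "\<lbrakk>f \<in> Ob (homcat B a b); g \<in> Ob (homcat B b c)\<rbrakk>
        \<Longrightarrow> nat_iso (Fib L c) (Fib L a)
              (comp_fnct (Pull L f) (Pull L g)) (Pull L (Hcmp1 B g f)) (ThC L f g)"
    and thC_natural: "\<lbrakk>\<alpha> \<in> hom (homcat B a b) f f'; \<beta> \<in> hom (homcat B b c) g g'; Z \<in> Ob (Fib L c)\<rbrakk>
        \<Longrightarrow> Pull2 L (Hcmp2 B \<beta> \<alpha>) Z \<cdot>\<^bsub>Fib L a\<^esub> ThC L f g Z =
            ThC L f' g' Z \<cdot>\<^bsub>Fib L a\<^esub>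
              (Pull2 L \<alpha> (fob (Pull L g') Z) \<cdot>\<^bsub>Fib L a\<^esub> far (Pull L f) (Pull2 L \<beta> Z))"
    and thC_assoc: "\<lbrakk>f \<in> Ob (homcat B a b); g \<in> Ob (homcat B b c); h \<in> Ob (homcat B c d);
          W \<in> Ob (Fib L d)\<rbrakk>
        \<Longrightarrow> Pull2 L (Asc B h g f) W \<cdot>\<^bsub>Fib L a\<^esub>
              (ThC L f (Hcmp1 B h g) W \<cdot>\<^bsub>Fib L a\<^esub> far (Pull L f) (ThC L g h W)) =
            ThC L (Hcmp1 B g f) h W \<cdot>\<^bsub>Fib L a\<^esub> ThC L f g (fob (Pull L h) W)"
    and thC_lun: "\<lbrakk>f \<in> Ob (homcat B a b); Y \<in> Ob (Fib L b)\<rbrakk>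
        \<Longrightarrow> Pull2 L (Lun B f) Y \<cdot>\<^bsub>Fib L a\<^esub>
              (ThC L f (Id1 B b) Y \<cdot>\<^bsub>Fib L a\<^esub> far (Pull L f) (ThI L b Y)) =
            Idt (Fib L a) (fob (Pull L f) Y)"
    and thC_run: "\<lbrakk>f \<in> Ob (homcat B a b); Y \<in> Ob (Fib L b)\<rbrakk>
        \<Longrightarrow> Pull2 L (Run B f) Y \<cdot>\<^bsub>Fib L a\<^esub>
              (ThC L (Id1 B a) f Y \<cdot>\<^bsub>Fib L a\<^esub> ThI L a (fob (Pull L f) Y)) =
            Idt (Fib L a) (fob (Pull L f) Y)"

definition restrict_along :: "('o, 'f, 't, 'x, 'm) icat \<Rightarrow> 'i set \<Rightarrow> ('i \<Rightarrow> 'f) \<Rightarrow>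
    ('x, 'm, 'i \<Rightarrow> 'x, 'i \<Rightarrow> 'm) fnct" where
  "restrict_along L I \<iota> =
     \<lparr>fob = (\<lambda>X. \<lambda>i\<in>I. fob (Pull L (\<iota> i)) X), far = (\<lambda>u. \<lambda>i\<in>I. far (Pull L (\<iota> i)) u)\<rparr>"

definition coproducts_to_products ::
  "('o, 'f, 't) bicat \<Rightarrow> ('o, 'f, 't, 'x, 'm) icat \<Rightarrow> bool" where
  "coproducts_to_products B L \<longleftrightarrow>
     (\<forall>(I :: nat set) A c \<iota>. finite I \<longrightarrow> is_bicoproduct B I A c \<iota> \<longrightarrow>
        is_equivalence (Fib L c) (prod_cat I (\<lambda>i. Fib L (A i))) (restrict_along L I \<iota>))"

section \<open>Coends in sets\<close>

text \<open>
  A functor \<open>P : C\<^sup>o\<^sup>p \<times> C \<rightarrow> Set\<close>; for \<open>\<phi> : f' \<rightarrow> f\<close> and \<open>\<psi> : g \<rightarrow> g'\<close>,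
  \<open>Pmap P \<phi> \<psi>\<close> maps \<open>Pset P f g\<close> to \<open>Pset P f' g'\<close>.
\<close>

record ('f, 't, 's) profunctor =
  Pset :: "'f \<Rightarrow> 'f \<Rightarrow> 's set"
  Pmap :: "'t \<Rightarrow> 't \<Rightarrow> 's \<Rightarrow> 's"

definition coend_dom :: "('f, 't) cat \<Rightarrow> ('f, 't, 's) profunctor \<Rightarrow> ('f \<times> 's) set" where
  "coend_dom C P = (SIGMA f:Ob C. Pset P f f)"

definition coend_step :: "('f, 't) cat \<Rightarrow> ('f, 't, 's) profunctor \<Rightarrow> (('f \<times> 's) \<times> ('f \<times> 's)) set" where
  "coend_step C P =
     {((f, Pmap P \<phi> (Idt C f) s), (g, Pmap P (Idt C g) \<phi> s)) | f g \<phi> s.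
        \<phi> \<in> hom C f g \<and> s \<in> Pset P g f}"

definition coend_rel :: "('f, 't) cat \<Rightarrow> ('f, 't, 's) profunctor \<Rightarrow> (('f \<times> 's) \<times> ('f \<times> 's)) set" where
  "coend_rel C P = (coend_step C P \<union> (coend_step C P)\<inverse>)\<^sup>*"

definition coend :: "('f, 't) cat \<Rightarrow> ('f, 't, 's) profunctor \<Rightarrow> ('f \<times> 's) set set" where
  "coend C P = coend_dom C P // coend_rel C P"

text \<open>
  \<open>coend_universal\<close> below is the universal property of this quotient.
\<close>

locale set_profunctor = category C
  for C :: "('f, 't) cat" +
  fixes P :: "('f, 't, 's) profunctor"
  assumes Pmap_closed: "\<lbrakk>\<phi> \<in> hom C f' f; \<psi> \<in> hom C g g'; s \<in> Pset P f g\<rbrakk>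
      \<Longrightarrow> Pmap P \<phi> \<psi> s \<in> Pset P f' g'"
    and Pmap_id: "\<lbrakk>f \<in> Ob C; g \<in> Ob C; s \<in> Pset P f g\<rbrakk> \<Longrightarrow> Pmap P (Idt C f) (Idt C g) s = s"
    and Pmap_comp: "\<lbrakk>\<phi> \<in> hom C f' f; \<phi>' \<in> hom C f'' f'; \<psi> \<in> hom C g g'; \<psi>' \<in> hom C g' g'';
        s \<in> Pset P f g\<rbrakk>
      \<Longrightarrow> Pmap P (\<phi> \<cdot>\<^bsub>C\<^esub> \<phi>') (\<psi>' \<cdot>\<^bsub>C\<^esub> \<psi>) s = Pmap P \<phi>' \<psi>' (Pmap P \<phi> \<psi> s)"
begin

lemma coend_step_subset: "coend_step C P \<subseteq> coend_dom C P \<times> coend_dom C P"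
proof -
  have "f \<in> Ob C \<and> g \<in> Ob C \<and> Pmap P \<phi> (Idt C f) s \<in> Pset P f f \<and> Pmap P (Idt C g) \<phi> s \<in> Pset P g g"
    if "\<phi> \<in> hom C f g" "s \<in> Pset P g f" for f g \<phi> s
  proof -
    have ob: "f \<in> Ob C" "g \<in> Ob C"
      using that(1) dom_closed cod_closed by (auto simp: hom_def)
    show ?thesis
      using ob Pmap_closed[OF that(1) id_hom[OF ob(1)] that(2)]
        Pmap_closed[OF id_hom[OF ob(2)] that(1,2)] by blast
  qed
  then show ?thesis
    unfolding coend_step_def coend_dom_def by blast
qed

lemma coend_rel_closed: "(p, q) \<in> coend_rel C P \<Longrightarrow> p \<in> coend_dom C P \<Longrightarrow> q \<in> coend_dom C P"
  unfolding coend_rel_def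
  by (induction rule: rtrancl_induct) (use coend_step_subset in auto)

end

lemma coend_rel_sym: "(p, q) \<in> coend_rel C P \<Longrightarrow> (q, p) \<in> coend_rel C P"
  unfolding coend_rel_def using sym_rtrancl[OF sym_Un_converse] by (rule symD)

lemma coend_rel_trans:
  "(p, q) \<in> coend_rel C P \<Longrightarrow> (q, r) \<in> coend_rel C P \<Longrightarrow> (p, r) \<in> coend_rel C P"
  unfolding coend_rel_def by (rule rtrancl_trans)

lemma coend_rel_refl [simp]: "(p, p) \<in> coend_rel C P"
  unfolding coend_rel_def by simp

lemma coend_class_eq_iff:
  "coend_rel C P `` {p} = coend_rel C P `` {q} \<longleftrightarrow> (p, q) \<in> coend_rel C P" (is "?l = ?r \<longleftrightarrow> _")
proof
  have "q \<in> ?r" by simp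
  moreover assume "?l = ?r"
  ultimately show "(p, q) \<in> coend_rel C P" by blast
next
  assume pq: "(p, q) \<in> coend_rel C P"
  show "?l = ?r"
    using coend_rel_trans[OF pq] coend_rel_trans[OF coend_rel_sym[OF pq]] by blast
qed

lemma coend_rel_invariant:
  assumes "(p, q) \<in> coend_rel C P"
    and "\<And>f g \<phi> s. \<lbrakk>\<phi> \<in> hom C f g; s \<in> Pset P g f\<rbrakk>
      \<Longrightarrow> k (f, Pmap P \<phi> (Idt C f) s) = k (g, Pmap P (Idt C g) \<phi> s)"
  shows "k p = k q"
  using assms(1) unfolding coend_rel_def
proof (induction rule: rtrancl_induct)
  case (step y z)
  then show ?case
    using assms(2) unfolding coend_step_def by fastforce
qed simp

lemma coend_universal:
  assumes k: "\<And>f g \<phi> s. \<lbrakk>\<phi> \<in> hom C f g; s \<in> Pset P g f\<rbrakk>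
      \<Longrightarrow> k f (Pmap P \<phi> (Idt C f) s) = k g (Pmap P (Idt C g) \<phi> s)"
  shows "\<exists>!h. h \<in> extensional (coend C P) \<and>
    (\<forall>f\<in>Ob C. \<forall>s\<in>Pset P f f. h (coend_rel C P `` {(f, s)}) = k f s)"
proof -
  let ?cl = "\<lambda>p. coend_rel C P `` {p}"
  let ?h = "\<lambda>q\<in>coend C P. the_elem ((\<lambda>(f, s). k f s) ` q)"
  have inv: "case_prod k p = case_prod k q" if "(p, q) \<in> coend_rel C P" for p q
    by (rule coend_rel_invariant[OF that]) (simp add: k)
  have img: "(\<lambda>(f, s). k f s) ` ?cl p = {case_prod k p}" for p
    using inv by (auto intro!: image_eqI[of _ _ p] simp: case_prod_beta)
  have cl: "?cl (f, s) \<in> coend C P" if "f \<in> Ob C" "s \<in> Pset P f f" for f s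
    using that by (auto simp: coend_def coend_dom_def quotient_def)
  have val: "?h (?cl (f, s)) = k f s" if "f \<in> Ob C" "s \<in> Pset P f f" for f s
    unfolding restrict_apply'[OF cl[OF that]] img by simp
  show ?thesis
  proof (rule ex1I[of _ ?h])
    show "?h \<in> extensional (coend C P) \<and> (\<forall>f\<in>Ob C. \<forall>s\<in>Pset P f f. ?h (?cl (f, s)) = k f s)"
      using val by blast
  next
    fix h assume h: "h \<in> extensional (coend C P) \<and>
      (\<forall>f\<in>Ob C. \<forall>s\<in>Pset P f f. h (coend_rel C P `` {(f, s)}) = k f s)"
    show "h = ?h"
    proof (rule extensionalityI[of _ "coend C P"])
      fix q assume "q \<in> coend C P"
      then obtain f s where fs: "q = ?cl (f, s)" "f \<in> Ob C" "s \<in> Pset P f f"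
        by (auto simp: coend_def coend_dom_def quotient_def)
      have "h (?cl (f, s)) = k f s" using h fs(2,3) by blast
      then show "h q = ?h q"
        unfolding fs(1) val[OF fs(2,3)] .
    qed (use h in auto)
  qed
qed

section \<open>Dependent optics\<close>

definition optic_prof ::
  "('o, 'f, 't, 'x, 'm) icat \<Rightarrow> ('o, 'f, 't, 'y, 'n) icat \<Rightarrow> 'o \<times> 'x \<times> 'y \<Rightarrow> 'o \<times> 'x \<times> 'y \<Rightarrow>
     ('f, 't, 'm \<times> 'n) profunctor" where
  "optic_prof L R = (\<lambda>(a, X, X') (b, Y, Y').
     \<lparr>Pset = (\<lambda>f g. hom (Fib L a) X (fob (Pull L g) Y) \<times> hom (Fib R a) (fob (Pull R f) Y') X'),
      Pmap = (\<lambda>\<phi> \<psi> (l, r). (Pull2 L \<psi> Y \<cdot>\<^bsub>Fib L a\<^esub> l, r \<cdot>\<^bsub>Fib R a\<^esub> Pull2 R \<phi> Y'))\<rparr>)"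

definition optic_hom ::
  "('o, 'f, 't) bicat \<Rightarrow> ('o, 'f, 't, 'x, 'm) icat \<Rightarrow> ('o, 'f, 't, 'y, 'n) icat \<Rightarrow>
     'o \<times> 'x \<times> 'y \<Rightarrow> 'o \<times> 'x \<times> 'y \<Rightarrow> ('f \<times> 'm \<times> 'n) set set" where
  "optic_hom B L R S T = coend (homcat B (fst S) (fst T)) (optic_prof L R S T)"

definition optic_class ::
  "('o, 'f, 't) bicat \<Rightarrow> ('o, 'f, 't, 'x, 'm) icat \<Rightarrow> ('o, 'f, 't, 'y, 'n) icat \<Rightarrow>
     'o \<times> 'x \<times> 'y \<Rightarrow> 'o \<times> 'x \<times> 'y \<Rightarrow> 'f \<times> 'm \<times> 'n \<Rightarrow> ('f \<times> 'm \<times> 'n) set" where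
  "optic_class B L R S T p = coend_rel (homcat B (fst S) (fst T)) (optic_prof L R S T) `` {p}"

definition optic_id_rep ::
  "('o, 'f, 't) bicat \<Rightarrow> ('o, 'f, 't, 'x, 'm) icat \<Rightarrow> ('o, 'f, 't, 'y, 'n) icat \<Rightarrow>
     'o \<times> 'x \<times> 'y \<Rightarrow> 'f \<times> 'm \<times> 'n" where
  "optic_id_rep B L R = (\<lambda>(a, X, X'). (Id1 B a, ThI L a X, inv_ar (Fib R a) (ThI R a X')))"

definition optic_comp_rep ::
  "('o, 'f, 't) bicat \<Rightarrow> ('o, 'f, 't, 'x, 'm) icat \<Rightarrow> ('o, 'f, 't, 'y, 'n) icat \<Rightarrow>
     'o \<times> 'x \<times> 'y \<Rightarrow> 'o \<times> 'x \<times> 'y \<Rightarrow> 'f \<times> 'm \<times> 'n \<Rightarrow> 'f \<times> 'm \<times> 'n \<Rightarrow> 'f \<times> 'm \<times> 'n" where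
  "optic_comp_rep B L R = (\<lambda>(a, X, X') (c, Z, Z') (g, l2, r2) (f, l1, r1).
     (Hcmp1 B g f,
      ThC L f g Z \<cdot>\<^bsub>Fib L a\<^esub> (far (Pull L f) l2 \<cdot>\<^bsub>Fib L a\<^esub> l1),
      (r1 \<cdot>\<^bsub>Fib R a\<^esub> far (Pull R f) r2) \<cdot>\<^bsub>Fib R a\<^esub> inv_ar (Fib R a) (ThC R f g Z')))"

text \<open>
  An arrow is an element of the coend tagged with its domain and codomain. The composite of two
  classes is the union of the classes of all composites of representatives, which is a single
  class; see \<open>optic_comp_class\<close> below.
\<close>

definition optic ::
  "('o, 'f, 't) bicat \<Rightarrow> ('o, 'f, 't, 'x, 'm) icat \<Rightarrow> ('o, 'f, 't, 'y, 'n) icat \<Rightarrow>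
     ('o \<times> 'x \<times> 'y, ('o \<times> 'x \<times> 'y) \<times> ('o \<times> 'x \<times> 'y) \<times> ('f \<times> 'm \<times> 'n) set) cat" where
  "optic B L R =
     (let obs = {(a, X, X'). a \<in> Ob0 B \<and> X \<in> Ob (Fib L a) \<and> X' \<in> Ob (Fib R a)} in
     \<lparr>Ob = obs,
      Ar = {(S, T, q). S \<in> obs \<and> T \<in> obs \<and> q \<in> optic_hom B L R S T},
      Dom = (\<lambda>(S, T, q). S),
      Cod = (\<lambda>(S, T, q). T),
      Idt = (\<lambda>S. (S, S, optic_class B L R S S (optic_id_rep B L R S))),
      Cmp = (\<lambda>(_, U, q2) (S, _, q1).
        (S, U, \<Union>p2\<in>q2. \<Union>p1\<in>q1. optic_class B L R S U (optic_comp_rep B L R S U p2 p1)))\<rparr>)"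

subsection \<open>Dependent optics form a category\<close>

context category
begin

lemma hom_ob: "f \<in> hom C a b \<Longrightarrow> a \<in> Ob C \<and> b \<in> Ob C"
  using dom_closed cod_closed by (auto simp: hom_def)

lemma inverse_unique:
  assumes "is_inverse C f g" "is_inverse C f g'"
  shows "g = g'"
proof -
  let ?a = "Dom C f" and ?b = "Cod C f"
  have f: "f \<in> hom C ?a ?b" and g: "g \<in> hom C ?b ?a" "g \<cdot> f = Idt C ?a"
    and g': "g' \<in> hom C ?b ?a" "f \<cdot> g' = Idt C ?b"
    using assms by (auto simp: is_inverse_def hom_def)
  have "g = g \<cdot> (f \<cdot> g')"
    unfolding g'(2) id_right[OF g(1)] ..
  also have "\<dots> = (g \<cdot> f) \<cdot> g'"
    by (rule assoc[OF g'(1) f g(1), symmetric])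
  also have "\<dots> = g'"
    unfolding g(2) by (rule id_left[OF g'(1)])
  finally show ?thesis .
qed

lemma inv_ar_props:
  assumes "f \<in> hom C a b" "is_iso C f"
  shows "inv_ar C f \<in> hom C b a" "inv_ar C f \<cdot> f = Idt C a" "f \<cdot> inv_ar C f = Idt C b"
proof -
  have "is_inverse C f (inv_ar C f)"
    unfolding inv_ar_def using assms(2) inverse_unique unfolding is_iso_def by (metis theI)
  then show "inv_ar C f \<in> hom C b a" "inv_ar C f \<cdot> f = Idt C a" "f \<cdot> inv_ar C f = Idt C b"
    using assms(1) by (auto simp: is_inverse_def hom_def)
qed

end

context category
begin

lemma comp_typing:
  assumes "f \<in> Ar C" "g \<in> Ar C" "Cod C f = Dom C g"
  shows "g \<cdot> f \<in> Ar C" "Dom C (g \<cdot> f) = Dom C f" "Cod C (g \<cdot> f) = Cod C g"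
proof -
  have "g \<cdot> f \<in> hom C (Dom C f) (Cod C g)"
    by (rule comp_hom[of f "Dom C f" "Dom C g" g "Cod C g"]) (simp_all add: hom_def assms)
  then show "g \<cdot> f \<in> Ar C" "Dom C (g \<cdot> f) = Dom C f" "Cod C (g \<cdot> f) = Cod C g"
    unfolding hom_def by blast+
qed

lemma assoc_typing:
  assumes "f \<in> Ar C" "g \<in> Ar C" "h \<in> Ar C" "Cod C f = Dom C g" "Cod C g = Dom C h"
  shows "(h \<cdot> g) \<cdot> f = h \<cdot> (g \<cdot> f)"
  by (rule assoc[of f "Dom C f" "Dom C g" g "Dom C h" h "Cod C h"]) (simp_all add: hom_def assms)

lemma id_typing:
  assumes "a \<in> Ob C"
  shows "Idt C a \<in> Ar C" "Dom C (Idt C a) = a" "Cod C (Idt C a) = a"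
  using id_hom[OF assms] unfolding hom_def by blast+

lemma id_cancel:
  assumes "f \<in> Ar C"
  shows "Cod C f = b \<Longrightarrow> Idt C b \<cdot> f = f" "Dom C f = a \<Longrightarrow> f \<cdot> Idt C a = f"
  by (rule id_left[of f "Dom C f"] id_right[of f _ "Cod C f"]; simp add: hom_def assms)+

lemmas calc = comp_typing assoc_typing id_typing id_cancel

end

context bicategory
begin

lemma homcat_ob: "f \<in> Ob (homcat B a b) \<Longrightarrow> a \<in> Ob0 B \<and> b \<in> Ob0 B"
  by (auto simp: homcat_def src_closed tgt_closed)

lemma homcat_hom:
  assumes "\<alpha> \<in> hom (homcat B a b) f g"
  shows "f \<in> Ob (homcat B a b) \<and> g \<in> Ob (homcat B a b) \<and> a \<in> Ob0 B \<and> b \<in> Ob0 B"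
proof -
  have "a \<in> Ob0 B \<and> b \<in> Ob0 B"
    using assms by (auto simp: homcat_def hom_def src_closed tgt_closed dom2_closed)
  then show ?thesis
    using category.hom_ob[OF homcat_category assms] by blast
qed

lemma id2_hom: "f \<in> Ob (homcat B a b) \<Longrightarrow> Id2 B f \<in> hom (homcat B a b) f f"
  using category.id_hom[OF homcat_category, of a b f] homcat_ob by (auto simp: homcat_def)

end

context indexed_category
begin

lemma fib_cat:
  assumes "f \<in> Ob (homcat B a b)"
  shows "category (Fib L a)" "category (Fib L b)"
  using homcat_ob[OF assms] fib by auto

lemma pull_ob: "\<lbrakk>f \<in> Ob (homcat B a b); Y \<in> Ob (Fib L b)\<rbrakk> \<Longrightarrow> fob (Pull L f) Y \<in> Ob (Fib L a)"
  using pull unfolding is_functor_def by blast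

lemma pull_hom: "\<lbrakk>f \<in> Ob (homcat B a b); u \<in> hom (Fib L b) Y Z\<rbrakk>
    \<Longrightarrow> far (Pull L f) u \<in> hom (Fib L a) (fob (Pull L f) Y) (fob (Pull L f) Z)"
  using pull unfolding is_functor_def by blast

lemma pull_id: "\<lbrakk>f \<in> Ob (homcat B a b); Y \<in> Ob (Fib L b)\<rbrakk>
    \<Longrightarrow> far (Pull L f) (Idt (Fib L b) Y) = Idt (Fib L a) (fob (Pull L f) Y)"
  using pull unfolding is_functor_def by blast

lemma pull_comp: "\<lbrakk>f \<in> Ob (homcat B a b); u \<in> hom (Fib L b) X Y; v \<in> hom (Fib L b) Y Z\<rbrakk>
    \<Longrightarrow> far (Pull L f) (v \<cdot>\<^bsub>Fib L b\<^esub> u) = far (Pull L f) v \<cdot>\<^bsub>Fib L a\<^esub> far (Pull L f) u"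
  using pull unfolding is_functor_def by blast

lemma pull2_hom: "\<lbrakk>\<alpha> \<in> hom (homcat B a b) f g; Y \<in> Ob (Fib L b)\<rbrakk>
    \<Longrightarrow> Pull2 L \<alpha> Y \<in> hom (Fib L a) (fob (Pull L f) Y) (fob (Pull L g) Y)"
  using pull2 unfolding nat_trans_def by blast

lemma pull2_nat: "\<lbrakk>\<alpha> \<in> hom (homcat B a b) f g; u \<in> hom (Fib L b) Y Z\<rbrakk>
    \<Longrightarrow> Pull2 L \<alpha> Z \<cdot>\<^bsub>Fib L a\<^esub> far (Pull L f) u = far (Pull L g) u \<cdot>\<^bsub>Fib L a\<^esub> Pull2 L \<alpha> Y"
  using pull2 unfolding nat_trans_def by blast

lemma thI_hom: "\<lbrakk>a \<in> Ob0 B; X \<in> Ob (Fib L a)\<rbrakk>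
    \<Longrightarrow> ThI L a X \<in> hom (Fib L a) X (fob (Pull L (Id1 B a)) X)"
  using thI unfolding nat_iso_def nat_trans_def id_fnct_def by fastforce

lemma thI_iso: "\<lbrakk>a \<in> Ob0 B; X \<in> Ob (Fib L a)\<rbrakk> \<Longrightarrow> is_iso (Fib L a) (ThI L a X)"
  using thI unfolding nat_iso_def by fastforce

lemma thI_nat: "\<lbrakk>a \<in> Ob0 B; u \<in> hom (Fib L a) X Y\<rbrakk>
    \<Longrightarrow> ThI L a Y \<cdot>\<^bsub>Fib L a\<^esub> u = far (Pull L (Id1 B a)) u \<cdot>\<^bsub>Fib L a\<^esub> ThI L a X"
  using thI unfolding nat_iso_def nat_trans_def id_fnct_def by fastforce

lemma thC_hom: "\<lbrakk>f \<in> Ob (homcat B a b); g \<in> Ob (homcat B b c); Z \<in> Ob (Fib L c)\<rbrakk>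
    \<Longrightarrow> ThC L f g Z \<in> hom (Fib L a) (fob (Pull L f) (fob (Pull L g) Z)) (fob (Pull L (Hcmp1 B g f)) Z)"
  using thC[of f a b g c] unfolding nat_iso_def nat_trans_def comp_fnct_def by auto

lemma thC_iso: "\<lbrakk>f \<in> Ob (homcat B a b); g \<in> Ob (homcat B b c); Z \<in> Ob (Fib L c)\<rbrakk>
    \<Longrightarrow> is_iso (Fib L a) (ThC L f g Z)"
  using thC[of f a b g c] unfolding nat_iso_def by auto

lemma thC_nat: "\<lbrakk>f \<in> Ob (homcat B a b); g \<in> Ob (homcat B b c); u \<in> hom (Fib L c) Y Z\<rbrakk>
    \<Longrightarrow> ThC L f g Z \<cdot>\<^bsub>Fib L a\<^esub> far (Pull L f) (far (Pull L g) u) =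
        far (Pull L (Hcmp1 B g f)) u \<cdot>\<^bsub>Fib L a\<^esub> ThC L f g Y"
  using thC[of f a b g c] unfolding nat_iso_def nat_trans_def comp_fnct_def by auto

lemma thIi_hom: "\<lbrakk>a \<in> Ob0 B; X \<in> Ob (Fib L a)\<rbrakk>
    \<Longrightarrow> inv_ar (Fib L a) (ThI L a X) \<in> hom (Fib L a) (fob (Pull L (Id1 B a)) X) X"
  using category.inv_ar_props(1)[OF fib thI_hom thI_iso] by auto

lemma thCi_hom: "\<lbrakk>f \<in> Ob (homcat B a b); g \<in> Ob (homcat B b c); Z \<in> Ob (Fib L c)\<rbrakk>
    \<Longrightarrow> inv_ar (Fib L a) (ThC L f g Z) \<in>
        hom (Fib L a) (fob (Pull L (Hcmp1 B g f)) Z) (fob (Pull L f) (fob (Pull L g) Z))"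
  using category.inv_ar_props(1)[OF fib_cat(1) thC_hom thC_iso] by auto

end

context category
begin

lemma inv_square:
  assumes "f \<in> hom C a b" "is_iso C f" "g \<in> hom C c d" "is_iso C g"
    and "u \<in> hom C a c" "v \<in> hom C b d" "v \<cdot> f = g \<cdot> u"
  shows "inv_ar C g \<cdot> v = u \<cdot> inv_ar C f"
proof -
  note fi = inv_ar_props[OF assms(1,2)] and gi = inv_ar_props[OF assms(3,4)]
  have "inv_ar C g \<cdot> v = inv_ar C g \<cdot> (v \<cdot> (f \<cdot> inv_ar C f))"
    unfolding fi(3) id_right[OF assms(6)] ..
  also have "\<dots> = (inv_ar C g \<cdot> (v \<cdot> f)) \<cdot> inv_ar C f"
    using assms(1,3,5,6) fi(1) gi(1) by (simp add: hom_def calc)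
  also have "\<dots> = ((inv_ar C g \<cdot> g) \<cdot> u) \<cdot> inv_ar C f"
    unfolding assms(7) using assms(1,3,5,6) fi(1) gi(1) by (simp add: hom_def calc)
  also have "\<dots> = u \<cdot> inv_ar C f"
    unfolding gi(2) id_left[OF assms(5)] ..
  finally show ?thesis .
qed

end

context indexed_category
begin

lemma thCi_nat:
  assumes "f \<in> Ob (homcat B a b)" "g \<in> Ob (homcat B b c)" "u \<in> hom (Fib L c) Y Z"
  shows "inv_ar (Fib L a) (ThC L f g Z) \<cdot>\<^bsub>Fib L a\<^esub> far (Pull L (Hcmp1 B g f)) u =
    far (Pull L f) (far (Pull L g) u) \<cdot>\<^bsub>Fib L a\<^esub> inv_ar (Fib L a) (ThC L f g Y)"
proof -
  have ob: "Y \<in> Ob (Fib L c)" "Z \<in> Ob (Fib L c)"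
    using category.hom_ob[OF fib_cat(2)[OF assms(2)] assms(3)] by auto
  show ?thesis
    by (rule category.inv_square[OF fib_cat(1)[OF assms(1)] thC_hom[OF assms(1,2) ob(1)]
          thC_iso[OF assms(1,2) ob(1)] thC_hom[OF assms(1,2) ob(2)] thC_iso[OF assms(1,2) ob(2)]
          pull_hom[OF assms(1) pull_hom[OF assms(2,3)]] pull_hom[OF hcmp1[OF assms(1,2)] assms(3)]])
      (simp add: thC_nat[OF assms])
qed

lemma thIi_nat:
  assumes "a \<in> Ob0 B" "u \<in> hom (Fib L a) X Y"
  shows "inv_ar (Fib L a) (ThI L a Y) \<cdot>\<^bsub>Fib L a\<^esub> far (Pull L (Id1 B a)) u =
    u \<cdot>\<^bsub>Fib L a\<^esub> inv_ar (Fib L a) (ThI L a X)"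
proof -
  have ob: "X \<in> Ob (Fib L a)" "Y \<in> Ob (Fib L a)"
    using category.hom_ob[OF fib[OF assms(1)] assms(2)] by auto
  show ?thesis
    by (rule category.inv_square[OF fib[OF assms(1)] thI_hom[OF assms(1) ob(1)]
          thI_iso[OF assms(1) ob(1)] thI_hom[OF assms(1) ob(2)] thI_iso[OF assms(1) ob(2)]
          assms(2) pull_hom[OF id1[OF assms(1)] assms(2)]])
      (simp add: thI_nat[OF assms])
qed

lemma thCi_natural:
  assumes "\<alpha> \<in> hom (homcat B a b) f f'" "\<beta> \<in> hom (homcat B b c) g g'" "Z \<in> Ob (Fib L c)"
  shows "inv_ar (Fib L a) (ThC L f' g' Z) \<cdot>\<^bsub>Fib L a\<^esub> Pull2 L (Hcmp2 B \<beta> \<alpha>) Z =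
    (Pull2 L \<alpha> (fob (Pull L g') Z) \<cdot>\<^bsub>Fib L a\<^esub> far (Pull L f) (Pull2 L \<beta> Z))
      \<cdot>\<^bsub>Fib L a\<^esub> inv_ar (Fib L a) (ThC L f g Z)"
proof -
  have o: "f \<in> Ob (homcat B a b)" "f' \<in> Ob (homcat B a b)" "g \<in> Ob (homcat B b c)"
    "g' \<in> Ob (homcat B b c)"
    using assms homcat_hom by blast+
  show ?thesis
    by (rule category.inv_square[OF fib_cat(1)[OF o(1)] thC_hom[OF o(1,3) assms(3)]
          thC_iso[OF o(1,3) assms(3)] thC_hom[OF o(2,4) assms(3)] thC_iso[OF o(2,4) assms(3)]
          category.comp_hom[OF fib_cat(1)[OF o(1)] pull_hom[OF o(1) pull2_hom[OF assms(2,3)]]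
            pull2_hom[OF assms(1) pull_ob[OF o(4) assms(3)]]]
          pull2_hom[OF hcmp2[OF assms(1,2)] assms(3)] thC_natural[OF assms]])
qed

lemma whisker_right:
  assumes "\<alpha> \<in> hom (homcat B a b) f f'" "g \<in> Ob (homcat B b c)" "Z \<in> Ob (Fib L c)"
  shows "Pull2 L (Hcmp2 B (Id2 B g) \<alpha>) Z \<cdot>\<^bsub>Fib L a\<^esub> ThC L f g Z =
      ThC L f' g Z \<cdot>\<^bsub>Fib L a\<^esub> Pull2 L \<alpha> (fob (Pull L g) Z)" (is ?A)
    and "inv_ar (Fib L a) (ThC L f' g Z) \<cdot>\<^bsub>Fib L a\<^esub> Pull2 L (Hcmp2 B (Id2 B g) \<alpha>) Z =
      Pull2 L \<alpha> (fob (Pull L g) Z) \<cdot>\<^bsub>Fib L a\<^esub> inv_ar (Fib L a) (ThC L f g Z)" (is ?B)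
proof -
  have f: "f \<in> Ob (homcat B a b)" using assms(1) homcat_hom by blast
  have "Pull2 L \<alpha> (fob (Pull L g) Z) \<cdot>\<^bsub>Fib L a\<^esub> far (Pull L f) (Pull2 L (Id2 B g) Z) =
      Pull2 L \<alpha> (fob (Pull L g) Z)"
    using pull2_id[OF assms(2,3)] pull_id[OF f pull_ob[OF assms(2,3)]]
      category.id_right[OF fib_cat(1)[OF f] pull2_hom[OF assms(1) pull_ob[OF assms(2,3)]]]
    by simp
  then show ?A ?B
    using thC_natural[OF assms(1) id2_hom[OF assms(2)] assms(3)]
      thCi_natural[OF assms(1) id2_hom[OF assms(2)] assms(3)] by simp_all
qed

lemma whisker_left:
  assumes "f \<in> Ob (homcat B a b)" "\<beta> \<in> hom (homcat B b c) g g'" "Z \<in> Ob (Fib L c)"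
  shows "Pull2 L (Hcmp2 B \<beta> (Id2 B f)) Z \<cdot>\<^bsub>Fib L a\<^esub> ThC L f g Z =
      ThC L f g' Z \<cdot>\<^bsub>Fib L a\<^esub> far (Pull L f) (Pull2 L \<beta> Z)" (is ?A)
    and "inv_ar (Fib L a) (ThC L f g' Z) \<cdot>\<^bsub>Fib L a\<^esub> Pull2 L (Hcmp2 B \<beta> (Id2 B f)) Z =
      far (Pull L f) (Pull2 L \<beta> Z) \<cdot>\<^bsub>Fib L a\<^esub> inv_ar (Fib L a) (ThC L f g Z)" (is ?B)
proof -
  have g: "g' \<in> Ob (homcat B b c)" using assms(2) homcat_hom by blast
  have "Pull2 L (Id2 B f) (fob (Pull L g') Z) \<cdot>\<^bsub>Fib L a\<^esub> far (Pull L f) (Pull2 L \<beta> Z) =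
      far (Pull L f) (Pull2 L \<beta> Z)"
    using pull2_id[OF assms(1) pull_ob[OF g assms(3)]]
      category.id_left[OF fib_cat(1)[OF assms(1)] pull_hom[OF assms(1) pull2_hom[OF assms(2,3)]]]
    by simp
  then show ?A ?B
    using thC_natural[OF id2_hom[OF assms(1)] assms(2,3)]
      thCi_natural[OF id2_hom[OF assms(1)] assms(2,3)] by simp_all
qed

lemma asc_right:
  assumes "f \<in> Ob (homcat B a b)" "g \<in> Ob (homcat B b c)" "h \<in> Ob (homcat B c d)"
    "W \<in> Ob (Fib L d)"
  shows "inv_ar (Fib L a) (ThC L f g (fob (Pull L h) W)) \<cdot>\<^bsub>Fib L a\<^esub>
      (inv_ar (Fib L a) (ThC L (Hcmp1 B g f) h W) \<cdot>\<^bsub>Fib L a\<^esub> Pull2 L (Asc B h g f) W) =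
    far (Pull L f) (inv_ar (Fib L b) (ThC L g h W)) \<cdot>\<^bsub>Fib L a\<^esub>
      inv_ar (Fib L a) (ThC L f (Hcmp1 B h g) W)"
proof -
  interpret C: category "Fib L a" using fib_cat(1)[OF assms(1)] .
  interpret D: category "Fib L b" using fib_cat(2)[OF assms(1)] .
  note gf = hcmp1[OF assms(1,2)] and hg = hcmp1[OF assms(2,3)] and hW = pull_ob[OF assms(3,4)]
  let ?p = "ThC L f g (fob (Pull L h) W)" and ?q = "ThC L (Hcmp1 B g f) h W"
    and ?u = "ThC L g h W" and ?r = "far (Pull L f) (ThC L g h W)"
    and ?s = "ThC L f (Hcmp1 B h g) W" and ?x = "Pull2 L (Asc B h g f) W"
  let ?ri = "far (Pull L f) (inv_ar (Fib L b) ?u)"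
  note p = thC_hom[OF assms(1,2) hW] and q = thC_hom[OF gf assms(3,4)]
    and u = thC_hom[OF assms(2-4)] and s = thC_hom[OF assms(1) hg assms(4)]
    and x = pull2_hom[OF conjunct1[OF asc[OF assms(1-3)]] assms(4)]
  note pi = C.inv_ar_props[OF p thC_iso[OF assms(1,2) hW]]
    and qi = C.inv_ar_props[OF q thC_iso[OF gf assms(3,4)]]
    and ui = D.inv_ar_props[OF u thC_iso[OF assms(2-4)]]
    and si = C.inv_ar_props[OF s thC_iso[OF assms(1) hg assms(4)]]
  note r = pull_hom[OF assms(1) u] and ri = pull_hom[OF assms(1) ui(1)]
  have rri: "?r \<cdot>\<^bsub>Fib L a\<^esub> ?ri = Idt (Fib L a) (fob (Pull L f) (fob (Pull L (Hcmp1 B h g)) W))"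
    using pull_comp[OF assms(1) ui(1) u] ui(3) pull_id[OF assms(1) pull_ob[OF hg assms(4)]] by simp
  have eq: "?x \<cdot>\<^bsub>Fib L a\<^esub> (?s \<cdot>\<^bsub>Fib L a\<^esub> ?r) = ?q \<cdot>\<^bsub>Fib L a\<^esub> ?p"
    by (rule thC_assoc[OF assms])
  note ty = p q r ri s x pi(1) qi(1) si(1)
  let ?pi = "inv_ar (Fib L a) ?p" and ?qi = "inv_ar (Fib L a) ?q" and ?si = "inv_ar (Fib L a) ?s"
  have 1: "(?s \<cdot>\<^bsub>Fib L a\<^esub> (?r \<cdot>\<^bsub>Fib L a\<^esub> ?ri)) \<cdot>\<^bsub>Fib L a\<^esub> ?si
      = Idt (Fib L a) (fob (Pull L (Hcmp1 B (Hcmp1 B h g) f)) W)"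
    unfolding rri using C.id_right[OF s] si by simp
  have "?pi \<cdot>\<^bsub>Fib L a\<^esub> (?qi \<cdot>\<^bsub>Fib L a\<^esub> ?x) = ?pi \<cdot>\<^bsub>Fib L a\<^esub> (?qi \<cdot>\<^bsub>Fib L a\<^esub> (?x \<cdot>\<^bsub>Fib L a\<^esub>
      ((?s \<cdot>\<^bsub>Fib L a\<^esub> (?r \<cdot>\<^bsub>Fib L a\<^esub> ?ri)) \<cdot>\<^bsub>Fib L a\<^esub> ?si)))"
    unfolding 1 using C.id_right[OF x] by simp
  also have "\<dots> = ?pi \<cdot>\<^bsub>Fib L a\<^esub> (?qi \<cdot>\<^bsub>Fib L a\<^esub> ((?x \<cdot>\<^bsub>Fib L a\<^esub> (?s \<cdot>\<^bsub>Fib L a\<^esub> ?r)) \<cdot>\<^bsub>Fib L a\<^esub> (?ri \<cdot>\<^bsub>Fib L a\<^esub> ?si)))"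
    using ty by (simp add: hom_def C.calc)
  also have "\<dots> = ?pi \<cdot>\<^bsub>Fib L a\<^esub> ((?qi \<cdot>\<^bsub>Fib L a\<^esub> ?q) \<cdot>\<^bsub>Fib L a\<^esub> (?p \<cdot>\<^bsub>Fib L a\<^esub> (?ri \<cdot>\<^bsub>Fib L a\<^esub> ?si)))"
    unfolding eq using ty by (simp add: hom_def C.calc)
  also have "\<dots> = ?pi \<cdot>\<^bsub>Fib L a\<^esub> (?p \<cdot>\<^bsub>Fib L a\<^esub> (?ri \<cdot>\<^bsub>Fib L a\<^esub> ?si))"
    unfolding qi(2) using ty by (simp add: hom_def C.calc)
  also have "\<dots> = (?pi \<cdot>\<^bsub>Fib L a\<^esub> ?p) \<cdot>\<^bsub>Fib L a\<^esub> (?ri \<cdot>\<^bsub>Fib L a\<^esub> ?si)"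
    using ty by (simp add: hom_def C.calc)
  also have "\<dots> = ?ri \<cdot>\<^bsub>Fib L a\<^esub> ?si"
    unfolding pi(2) using ty by (simp add: hom_def C.calc)
  finally show ?thesis .
qed

lemma lun_right:
  assumes f: "f \<in> Ob (homcat B a b)" and Y: "Y \<in> Ob (Fib L b)"
  shows "far (Pull L f) (inv_ar (Fib L b) (ThI L b Y)) \<cdot>\<^bsub>Fib L a\<^esub>
    inv_ar (Fib L a) (ThC L f (Id1 B b) Y) = Pull2 L (Lun B f) Y"
proof -
  interpret C: category "Fib L a" using fib_cat(1)[OF f] .
  interpret D: category "Fib L b" using fib_cat(2)[OF f] .
  have b: "b \<in> Ob0 B" using homcat_ob[OF f] by simp
  note i = id1[OF b]
  note x = pull2_hom[OF conjunct1[OF lun[OF f]] Y]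
    and s = thC_hom[OF f i Y] and u = thI_hom[OF b Y]
  note si = C.inv_ar_props[OF s thC_iso[OF f i Y]] and ui = D.inv_ar_props[OF u thI_iso[OF b Y]]
  note r = pull_hom[OF f u] and ri = pull_hom[OF f ui(1)]
  let ?x = "Pull2 L (Lun B f) Y" and ?s = "ThC L f (Id1 B b) Y" and ?r = "far (Pull L f) (ThI L b Y)"
    and ?ri = "far (Pull L f) (inv_ar (Fib L b) (ThI L b Y))"
  have rri: "?r \<cdot>\<^bsub>Fib L a\<^esub> ?ri = Idt (Fib L a) (fob (Pull L f) (fob (Pull L (Id1 B b)) Y))"
    using pull_comp[OF f ui(1) u] ui(3) pull_id[OF f pull_ob[OF i Y]] by simp
  note ty = x s r ri si(1)
  have 1: "(?s \<cdot>\<^bsub>Fib L a\<^esub> (?r \<cdot>\<^bsub>Fib L a\<^esub> ?ri)) \<cdot>\<^bsub>Fib L a\<^esub> inv_ar (Fib L a) ?s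
      = Idt (Fib L a) (fob (Pull L (Hcmp1 B (Id1 B b) f)) Y)"
    unfolding rri using C.id_right[OF s] si by simp
  have "?x = ?x \<cdot>\<^bsub>Fib L a\<^esub> ((?s \<cdot>\<^bsub>Fib L a\<^esub> (?r \<cdot>\<^bsub>Fib L a\<^esub> ?ri)) \<cdot>\<^bsub>Fib L a\<^esub> inv_ar (Fib L a) ?s)"
    unfolding 1 using C.id_right[OF x] by simp
  also have "\<dots> = (?x \<cdot>\<^bsub>Fib L a\<^esub> (?s \<cdot>\<^bsub>Fib L a\<^esub> ?r)) \<cdot>\<^bsub>Fib L a\<^esub> (?ri \<cdot>\<^bsub>Fib L a\<^esub> inv_ar (Fib L a) ?s)"
    using ty by (simp add: hom_def C.calc)
  also have "\<dots> = ?ri \<cdot>\<^bsub>Fib L a\<^esub> inv_ar (Fib L a) ?s"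
    unfolding thC_lun[OF f Y] using ty by (simp add: hom_def C.calc)
  finally show ?thesis by simp
qed

lemma run_right:
  assumes f: "f \<in> Ob (homcat B a b)" and Y: "Y \<in> Ob (Fib L b)"
  shows "inv_ar (Fib L a) (ThI L a (fob (Pull L f) Y)) \<cdot>\<^bsub>Fib L a\<^esub>
    inv_ar (Fib L a) (ThC L (Id1 B a) f Y) = Pull2 L (Run B f) Y"
proof -
  interpret C: category "Fib L a" using fib_cat(1)[OF f] .
  have a: "a \<in> Ob0 B" using homcat_ob[OF f] by simp
  note i = id1[OF a] and fY = pull_ob[OF f Y]
  note x = pull2_hom[OF conjunct1[OF run[OF f]] Y]
    and s = thC_hom[OF i f Y] and r = thI_hom[OF a fY]
  note si = C.inv_ar_props[OF s thC_iso[OF i f Y]] and ri = C.inv_ar_props[OF r thI_iso[OF a fY]]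
  let ?x = "Pull2 L (Run B f) Y" and ?s = "ThC L (Id1 B a) f Y" and ?r = "ThI L a (fob (Pull L f) Y)"
  let ?ri = "inv_ar (Fib L a) ?r"
  note ty = x s r ri(1) si(1)
  have 1: "(?s \<cdot>\<^bsub>Fib L a\<^esub> (?r \<cdot>\<^bsub>Fib L a\<^esub> ?ri)) \<cdot>\<^bsub>Fib L a\<^esub> inv_ar (Fib L a) ?s
      = Idt (Fib L a) (fob (Pull L (Hcmp1 B f (Id1 B a))) Y)"
    unfolding ri using C.id_right[OF s] si by simp
  have "?x = ?x \<cdot>\<^bsub>Fib L a\<^esub> ((?s \<cdot>\<^bsub>Fib L a\<^esub> (?r \<cdot>\<^bsub>Fib L a\<^esub> ?ri)) \<cdot>\<^bsub>Fib L a\<^esub> inv_ar (Fib L a) ?s)"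
    unfolding 1 using C.id_right[OF x] by simp
  also have "\<dots> = (?x \<cdot>\<^bsub>Fib L a\<^esub> (?s \<cdot>\<^bsub>Fib L a\<^esub> ?r)) \<cdot>\<^bsub>Fib L a\<^esub> (?ri \<cdot>\<^bsub>Fib L a\<^esub> inv_ar (Fib L a) ?s)"
    using ty by (simp add: hom_def C.calc)
  also have "\<dots> = ?ri \<cdot>\<^bsub>Fib L a\<^esub> inv_ar (Fib L a) ?s"
    unfolding thC_run[OF f Y] using ty by (simp add: hom_def C.calc)
  finally show ?thesis by simp
qed

end

locale optic_setting = L: indexed_category B L + R: indexed_category B R
  for B :: "('o, 'f, 't) bicat"
    and L :: "('o, 'f, 't, 'x, 'm) icat"
    and R :: "('o, 'f, 't, 'y, 'n) icat"
begin

definition reps :: "'o \<times> 'x \<times> 'y \<Rightarrow> 'o \<times> 'x \<times> 'y \<Rightarrow> ('f \<times> 'm \<times> 'n) set" where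
  "reps S T = coend_dom (homcat B (fst S) (fst T)) (optic_prof L R S T)"

definition eqv :: "'o \<times> 'x \<times> 'y \<Rightarrow> 'o \<times> 'x \<times> 'y \<Rightarrow> (('f \<times> 'm \<times> 'n) \<times> ('f \<times> 'm \<times> 'n)) set" where
  "eqv S T = coend_rel (homcat B (fst S) (fst T)) (optic_prof L R S T)"

lemma reps_iff:
  "(f, l, r) \<in> reps (a, X, X') (b, Y, Y') \<longleftrightarrow>
    f \<in> Ob (homcat B a b) \<and> l \<in> hom (Fib L a) X (fob (Pull L f) Y)
    \<and> r \<in> hom (Fib R a) (fob (Pull R f) Y') X'"
  by (auto simp: reps_def coend_dom_def optic_prof_def)

lemma step_cases:
  assumes "(p, q) \<in> coend_step (homcat B a b) (optic_prof L R (a, X, X') (b, Y, Y'))"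
    and "Y \<in> Ob (Fib L b)" "Y' \<in> Ob (Fib R b)"
  obtains f g \<phi> l r where "\<phi> \<in> hom (homcat B a b) f g"
    "l \<in> hom (Fib L a) X (fob (Pull L f) Y)" "r \<in> hom (Fib R a) (fob (Pull R g) Y') X'"
    "p = (f, l, r \<cdot>\<^bsub>Fib R a\<^esub> Pull2 R \<phi> Y')" "q = (g, Pull2 L \<phi> Y \<cdot>\<^bsub>Fib L a\<^esub> l, r)"
proof -
  from assms(1) obtain f g \<phi> l r where *: "\<phi> \<in> hom (homcat B a b) f g"
    "l \<in> hom (Fib L a) X (fob (Pull L f) Y)" "r \<in> hom (Fib R a) (fob (Pull R g) Y') X'"
    "p = (f, Pull2 L (Id2 B f) Y \<cdot>\<^bsub>Fib L a\<^esub> l, r \<cdot>\<^bsub>Fib R a\<^esub> Pull2 R \<phi> Y')"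
    "q = (g, Pull2 L \<phi> Y \<cdot>\<^bsub>Fib L a\<^esub> l, r \<cdot>\<^bsub>Fib R a\<^esub> Pull2 R (Id2 B g) Y')"
    by (auto simp: coend_step_def optic_prof_def homcat_def)
  have o: "f \<in> Ob (homcat B a b)" "g \<in> Ob (homcat B a b)"
    using L.homcat_hom[OF *(1)] by auto
  show thesis
    by (rule that[OF *(1-3)])
      (use *(4,5) L.pull2_id[OF o(1) assms(2)] R.pull2_id[OF o(2) assms(3)]
        category.id_left[OF L.fib_cat(1)[OF o(1)] *(2)]
        category.id_right[OF R.fib_cat(1)[OF o(2)] *(3)] in simp_all)
qed

lemma eqv_stepI:
  assumes \<phi>: "\<phi> \<in> hom (homcat B a b) f g"
    and "(f, l, r) \<in> reps (a, X, X') (b, Y, Y')" "(g, l', r') \<in> reps (a, X, X') (b, Y, Y')"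
    and "Y \<in> Ob (Fib L b)" "Y' \<in> Ob (Fib R b)"
    and "l' = Pull2 L \<phi> Y \<cdot>\<^bsub>Fib L a\<^esub> l" "r = r' \<cdot>\<^bsub>Fib R a\<^esub> Pull2 R \<phi> Y'"
  shows "((f, l, r), (g, l', r')) \<in> eqv (a, X, X') (b, Y, Y')"
proof -
  have t: "l \<in> hom (Fib L a) X (fob (Pull L f) Y)" "r' \<in> hom (Fib R a) (fob (Pull R g) Y') X'"
    and o: "f \<in> Ob (homcat B a b)" "g \<in> Ob (homcat B a b)"
    using assms(2,3) by (auto simp: reps_iff)
  have "Pull2 L (Id2 B f) Y \<cdot>\<^bsub>Fib L a\<^esub> l = l" "r' \<cdot>\<^bsub>Fib R a\<^esub> Pull2 R (Id2 B g) Y' = r'"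
    using L.pull2_id[OF o(1) assms(4)] R.pull2_id[OF o(2) assms(5)]
      category.id_left[OF L.fib_cat(1)[OF o(1)] t(1)]
      category.id_right[OF R.fib_cat(1)[OF o(2)] t(2)] by simp_all
  then have "((f, l, r), (g, l', r')) \<in>
      coend_step (homcat B a b) (optic_prof L R (a, X, X') (b, Y, Y'))"
    unfolding coend_step_def using t \<phi> assms(6,7)
    by (auto simp: optic_prof_def homcat_def
        intro!: exI[of _ f] exI[of _ g] exI[of _ \<phi>] exI[of _ l] exI[of _ r'])
  then show ?thesis
    unfolding eqv_def coend_rel_def by auto
qed

lemma set_profunctor_optic:
  assumes "a \<in> Ob0 B" "b \<in> Ob0 B" "X \<in> Ob (Fib L a)" "X' \<in> Ob (Fib R a)"
    and "Y \<in> Ob (Fib L b)" "Y' \<in> Ob (Fib R b)"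
  shows "set_profunctor (homcat B a b) (optic_prof L R (a, X, X') (b, Y, Y'))"
proof -
  interpret C: category "homcat B a b" using L.homcat_category assms by blast
  interpret FL: category "Fib L a" using L.fib assms by blast
  interpret FR: category "Fib R a" using R.fib assms by blast
  have [simp]: "Idt (homcat B a b) = Id2 B" "Cmp (homcat B a b) = Vcmp B"
    by (simp_all add: homcat_def)
  show ?thesis
  proof unfold_locales
    fix f f' g g' \<phi> \<psi> and s :: "'m \<times> 'n"
    assume "\<phi> \<in> hom (homcat B a b) f' f" "\<psi> \<in> hom (homcat B a b) g g'"
      "s \<in> Pset (optic_prof L R (a, X, X') (b, Y, Y')) f g"
    then show "Pmap (optic_prof L R (a, X, X') (b, Y, Y')) \<phi> \<psi> s
        \<in> Pset (optic_prof L R (a, X, X') (b, Y, Y')) f' g'"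
      using L.pull2_hom[of \<psi> a b g g' Y] R.pull2_hom[of \<phi> a b f' f Y'] assms
      by (auto simp: optic_prof_def intro: FL.comp_hom FR.comp_hom)
  next
    fix f g and s :: "'m \<times> 'n"
    assume "f \<in> Ob (homcat B a b)" "g \<in> Ob (homcat B a b)"
      "s \<in> Pset (optic_prof L R (a, X, X') (b, Y, Y')) f g"
    then show "Pmap (optic_prof L R (a, X, X') (b, Y, Y'))
        (Idt (homcat B a b) f) (Idt (homcat B a b) g) s = s"
      using L.pull2_id[of g a b Y] R.pull2_id[of f a b Y'] assms
      by (auto simp: optic_prof_def FL.id_left FR.id_right)
  next
    fix f f' f'' g g' g'' \<phi> \<phi>' \<psi> \<psi>' and s :: "'m \<times> 'n"
    assume *: "\<phi> \<in> hom (homcat B a b) f' f" "\<phi>' \<in> hom (homcat B a b) f'' f'"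
      "\<psi> \<in> hom (homcat B a b) g g'" "\<psi>' \<in> hom (homcat B a b) g' g''"
      "s \<in> Pset (optic_prof L R (a, X, X') (b, Y, Y')) f g"
    note h = L.pull2_hom[OF *(3) assms(5)] L.pull2_hom[OF *(4) assms(5)]
      R.pull2_hom[OF *(1) assms(6)] R.pull2_hom[OF *(2) assms(6)]
    show "Pmap (optic_prof L R (a, X, X') (b, Y, Y'))
        (\<phi> \<cdot>\<^bsub>homcat B a b\<^esub> \<phi>') (\<psi>' \<cdot>\<^bsub>homcat B a b\<^esub> \<psi>) s =
      Pmap (optic_prof L R (a, X, X') (b, Y, Y')) \<phi>' \<psi>'
        (Pmap (optic_prof L R (a, X, X') (b, Y, Y')) \<phi> \<psi> s)"
      using *(5) L.pull2_vcmp[OF *(3,4) assms(5)] R.pull2_vcmp[OF *(2,1) assms(6)]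
        FL.assoc[OF _ h(1,2)] FR.assoc[OF h(4,3)]
      by (auto simp: optic_prof_def)
  qed
qed

definition is_ob :: "'o \<times> 'x \<times> 'y \<Rightarrow> bool" where
  "is_ob S \<longleftrightarrow> S \<in> Ob (optic B L R)"

lemma is_ob_iff: "is_ob (a, X, X') \<longleftrightarrow> a \<in> Ob0 B \<and> X \<in> Ob (Fib L a) \<and> X' \<in> Ob (Fib R a)"
  by (auto simp: is_ob_def optic_def Let_def)

lemma eqv_reps:
  assumes "is_ob S" "is_ob T" "(p, q) \<in> eqv S T" "p \<in> reps S T"
  shows "q \<in> reps S T"
proof (cases S; cases T)
  fix a X X' b Y Y' assume ST: "S = (a, X, X')" "T = (b, Y, Y')"
  interpret set_profunctor "homcat B a b" "optic_prof L R (a, X, X') (b, Y, Y')"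
    by (rule set_profunctor_optic) (use assms(1,2) ST in \<open>auto simp: is_ob_iff\<close>)
  show ?thesis
    using coend_rel_closed[of p q] assms(3,4) by (simp add: ST reps_def eqv_def)
qed

lemma eqv_invariant:
  assumes "(p, q) \<in> eqv S T" "p \<in> reps S T" "is_ob S" "is_ob T"
    and "\<And>p q. (p, q) \<in> coend_step (homcat B (fst S) (fst T)) (optic_prof L R S T)
      \<Longrightarrow> p \<in> reps S T \<Longrightarrow> q \<in> reps S T \<Longrightarrow> (k p, k q) \<in> eqv S' T'"
  shows "(k p, k q) \<in> eqv S' T'"
proof -
  have "(k p, k q) \<in> eqv S' T' \<and> q \<in> reps S T"
    using assms(1)[unfolded eqv_def coend_rel_def]
  proof (induction rule: rtrancl_induct)
    case base
    then show ?case using assms(2) by (simp add: eqv_def)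
  next
    case (step y z)
    have "(y, z) \<in> eqv S T"
      using step(2) unfolding eqv_def coend_rel_def by (rule r_into_rtrancl)
    then have z: "z \<in> reps S T" using eqv_reps assms(3,4) step(3) by blast
    have "(k y, k z) \<in> eqv S' T'"
      using step(2,3) z assms(5)[of y z] assms(5)[of z y] coend_rel_sym unfolding eqv_def by blast
    then show ?case using step(3) z unfolding eqv_def by (blast intro: coend_rel_trans)
  qed
  then show ?thesis ..
qed

lemma id_rep: "is_ob S \<Longrightarrow> optic_id_rep B L R S \<in> reps S S"
  by (cases S) (auto simp: is_ob_iff optic_id_rep_def reps_iff intro: L.id1 L.thI_hom R.thIi_hom)

lemma comp_rep:
  assumes "is_ob S" "is_ob T" "is_ob U" "p \<in> reps S T" "q \<in> reps T U"
  shows "optic_comp_rep B L R S U q p \<in> reps S U"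
proof (cases S; cases T; cases U; cases p; cases q)
  fix a X X' b Y Y' c Z Z' f l1 r1 g l2 r2
  assume *: "S = (a, X, X')" "T = (b, Y, Y')" "U = (c, Z, Z')" "p = (f, l1, r1)" "q = (g, l2, r2)"
  have f: "f \<in> Ob (homcat B a b)" "l1 \<in> hom (Fib L a) X (fob (Pull L f) Y)"
      "r1 \<in> hom (Fib R a) (fob (Pull R f) Y') X'"
    and g: "g \<in> Ob (homcat B b c)" "l2 \<in> hom (Fib L b) Y (fob (Pull L g) Z)"
      "r2 \<in> hom (Fib R b) (fob (Pull R g) Z') Y'"
    and Z: "Z \<in> Ob (Fib L c)" "Z' \<in> Ob (Fib R c)"
    using assms by (auto simp: * reps_iff is_ob_iff)
  note LC = category.comp_hom[OF L.fib_cat(1)[OF f(1)]]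
    and RC = category.comp_hom[OF R.fib_cat(1)[OF f(1)]]
  show ?thesis
    unfolding * optic_comp_rep_def prod.case reps_iff
    by (intro conjI L.hcmp1[OF f(1) g(1)] LC[OF LC[OF f(2) L.pull_hom[OF f(1) g(2)]] L.thC_hom[OF f(1) g(1) Z(1)]]
      RC[OF R.thCi_hom[OF f(1) g(1) Z(2)] RC[OF R.pull_hom[OF f(1) g(3)] f(3)]])
qed

lemma comp_cong1:
  assumes S: "is_ob S" and T: "is_ob T" and U: "is_ob U"
    and pp: "(p, p') \<in> eqv S T" and p: "p \<in> reps S T" and q: "q \<in> reps T U"
  shows "(optic_comp_rep B L R S U q p, optic_comp_rep B L R S U q p') \<in> eqv S U"
proof (rule eqv_invariant[OF pp p S T])
  fix p p' assume st: "(p, p') \<in> coend_step (homcat B (fst S) (fst T)) (optic_prof L R S T)"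
    and pr: "p \<in> reps S T" "p' \<in> reps S T"
  obtain a X X' b Y Y' c Z Z' g l2 r2
    where *: "S = (a, X, X')" "T = (b, Y, Y')" "U = (c, Z, Z')" "q = (g, l2, r2)"
    by (cases S; cases T; cases U; cases q; rule that; assumption)
  have g: "g \<in> Ob (homcat B b c)" "l2 \<in> hom (Fib L b) Y (fob (Pull L g) Z)"
      "r2 \<in> hom (Fib R b) (fob (Pull R g) Z') Y'"
    and Y: "Y \<in> Ob (Fib L b)" "Y' \<in> Ob (Fib R b)"
    and Z: "Z \<in> Ob (Fib L c)" "Z' \<in> Ob (Fib R c)"
    using S T U q by (auto simp: * reps_iff is_ob_iff)
  obtain f f' \<phi> l r where \<phi>: "\<phi> \<in> hom (homcat B a b) f f'"
    and lr: "l \<in> hom (Fib L a) X (fob (Pull L f) Y)" "r \<in> hom (Fib R a) (fob (Pull R f') Y') X'"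
    and p: "p = (f, l, r \<cdot>\<^bsub>Fib R a\<^esub> Pull2 R \<phi> Y')" "p' = (f', Pull2 L \<phi> Y \<cdot>\<^bsub>Fib L a\<^esub> l, r)"
    by (rule step_cases[OF st[unfolded * fst_conv] Y]; rule that; assumption)
  have f: "f \<in> Ob (homcat B a b)" "f' \<in> Ob (homcat B a b)" using L.homcat_hom[OF \<phi>] by auto
  interpret CL: category "Fib L a" by (rule L.fib_cat(1)[OF f(1)])
  interpret CR: category "Fib R a" by (rule R.fib_cat(1)[OF f(1)])
  note w = L.hcmp2[OF \<phi> L.id2_hom[OF g(1)]]
  note tyL = lr(1) L.pull2_hom[OF \<phi> Y(1)] L.pull2_hom[OF \<phi> L.pull_ob[OF g(1) Z(1)]]
      L.pull_hom[OF f(1) g(2)] L.pull_hom[OF f(2) g(2)] L.thC_hom[OF f(1) g(1) Z(1)]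
      L.thC_hom[OF f(2) g(1) Z(1)] L.pull2_hom[OF w Z(1)]
  note tyR = lr(2) R.pull2_hom[OF \<phi> Y(2)] R.pull2_hom[OF \<phi> R.pull_ob[OF g(1) Z(2)]]
      R.pull_hom[OF f(1) g(3)] R.pull_hom[OF f(2) g(3)] R.thCi_hom[OF f(1) g(1) Z(2)]
      R.thCi_hom[OF f(2) g(1) Z(2)] R.pull2_hom[OF w Z(2)]
  have eL: "ThC L f' g Z \<cdot>\<^bsub>Fib L a\<^esub> (far (Pull L f') l2 \<cdot>\<^bsub>Fib L a\<^esub> (Pull2 L \<phi> Y \<cdot>\<^bsub>Fib L a\<^esub> l)) =
      Pull2 L (Hcmp2 B (Id2 B g) \<phi>) Z \<cdot>\<^bsub>Fib L a\<^esub>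
        (ThC L f g Z \<cdot>\<^bsub>Fib L a\<^esub> (far (Pull L f) l2 \<cdot>\<^bsub>Fib L a\<^esub> l))" (is "?x = ?y")
  proof -
    have "?x = ThC L f' g Z \<cdot>\<^bsub>Fib L a\<^esub> ((far (Pull L f') l2 \<cdot>\<^bsub>Fib L a\<^esub> Pull2 L \<phi> Y) \<cdot>\<^bsub>Fib L a\<^esub> l)"
      using tyL by (simp add: hom_def CL.calc)
    also have "\<dots> = (ThC L f' g Z \<cdot>\<^bsub>Fib L a\<^esub> Pull2 L \<phi> (fob (Pull L g) Z)) \<cdot>\<^bsub>Fib L a\<^esub>
        (far (Pull L f) l2 \<cdot>\<^bsub>Fib L a\<^esub> l)"
      unfolding L.pull2_nat[OF \<phi> g(2), symmetric] using tyL by (simp add: hom_def CL.calc)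
    also have "\<dots> = ?y"
      unfolding L.whisker_right(1)[OF \<phi> g(1) Z(1), symmetric] using tyL by (simp add: hom_def CL.calc)
    finally show ?thesis .
  qed
  have eR: "((r \<cdot>\<^bsub>Fib R a\<^esub> Pull2 R \<phi> Y') \<cdot>\<^bsub>Fib R a\<^esub> far (Pull R f) r2) \<cdot>\<^bsub>Fib R a\<^esub>
        inv_ar (Fib R a) (ThC R f g Z') =
      ((r \<cdot>\<^bsub>Fib R a\<^esub> far (Pull R f') r2) \<cdot>\<^bsub>Fib R a\<^esub> inv_ar (Fib R a) (ThC R f' g Z'))
        \<cdot>\<^bsub>Fib R a\<^esub> Pull2 R (Hcmp2 B (Id2 B g) \<phi>) Z'" (is "?x = ?y")
  proof -
    have "?y = (r \<cdot>\<^bsub>Fib R a\<^esub> far (Pull R f') r2) \<cdot>\<^bsub>Fib R a\<^esub>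
        (inv_ar (Fib R a) (ThC R f' g Z') \<cdot>\<^bsub>Fib R a\<^esub> Pull2 R (Hcmp2 B (Id2 B g) \<phi>) Z')"
      using tyR by (simp add: hom_def CR.calc)
    also have "\<dots> = r \<cdot>\<^bsub>Fib R a\<^esub> ((far (Pull R f') r2 \<cdot>\<^bsub>Fib R a\<^esub> Pull2 R \<phi> (fob (Pull R g) Z'))
        \<cdot>\<^bsub>Fib R a\<^esub> inv_ar (Fib R a) (ThC R f g Z'))"
      unfolding R.whisker_right(2)[OF \<phi> g(1) Z(2)] using tyR by (simp add: hom_def CR.calc)
    also have "\<dots> = ?x"
      unfolding R.pull2_nat[OF \<phi> g(3), symmetric] using tyR by (simp add: hom_def CR.calc)
    finally show ?thesis by simp
  qed
  show "(optic_comp_rep B L R S U q p, optic_comp_rep B L R S U q p') \<in> eqv S U"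
    using comp_rep[OF S T U pr(1) q] comp_rep[OF S T U pr(2) q]
    unfolding p * optic_comp_rep_def prod.case
    by (intro eqv_stepI[OF w _ _ Z eL eR])
qed

lemma comp_cong2:
  assumes S: "is_ob S" and T: "is_ob T" and U: "is_ob U"
    and qq: "(q, q') \<in> eqv T U" and q: "q \<in> reps T U" and p: "p \<in> reps S T"
  shows "(optic_comp_rep B L R S U q p, optic_comp_rep B L R S U q' p) \<in> eqv S U"
proof (rule eqv_invariant[OF qq q T U])
  fix q q' assume st: "(q, q') \<in> coend_step (homcat B (fst T) (fst U)) (optic_prof L R T U)"
    and qr: "q \<in> reps T U" "q' \<in> reps T U"
  obtain a X X' b Y Y' c Z Z' f l1 r1
    where *: "S = (a, X, X')" "T = (b, Y, Y')" "U = (c, Z, Z')" "p = (f, l1, r1)"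
    by (cases S; cases T; cases U; cases p; rule that; assumption)
  have f: "f \<in> Ob (homcat B a b)" "l1 \<in> hom (Fib L a) X (fob (Pull L f) Y)"
      "r1 \<in> hom (Fib R a) (fob (Pull R f) Y') X'"
    and Z: "Z \<in> Ob (Fib L c)" "Z' \<in> Ob (Fib R c)"
    using S T U p by (auto simp: * reps_iff is_ob_iff)
  obtain g g' \<psi> l r where \<psi>: "\<psi> \<in> hom (homcat B b c) g g'"
    and lr: "l \<in> hom (Fib L b) Y (fob (Pull L g) Z)" "r \<in> hom (Fib R b) (fob (Pull R g') Z') Y'"
    and q: "q = (g, l, r \<cdot>\<^bsub>Fib R b\<^esub> Pull2 R \<psi> Z')" "q' = (g', Pull2 L \<psi> Z \<cdot>\<^bsub>Fib L b\<^esub> l, r)"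
    by (rule step_cases[OF st[unfolded * fst_conv] Z]; rule that; assumption)
  have g: "g \<in> Ob (homcat B b c)" "g' \<in> Ob (homcat B b c)" using L.homcat_hom[OF \<psi>] by auto
  interpret CL: category "Fib L a" by (rule L.fib_cat(1)[OF f(1)])
  interpret CR: category "Fib R a" by (rule R.fib_cat(1)[OF f(1)])
  note w = L.hcmp2[OF L.id2_hom[OF f(1)] \<psi>]
  note tyL = f(2) L.pull_hom[OF f(1) lr(1)] L.pull_hom[OF f(1) L.pull2_hom[OF \<psi> Z(1)]]
      L.thC_hom[OF f(1) g(1) Z(1)] L.thC_hom[OF f(1) g(2) Z(1)] L.pull2_hom[OF w Z(1)]
  note tyR = f(3) R.pull_hom[OF f(1) lr(2)] R.pull_hom[OF f(1) R.pull2_hom[OF \<psi> Z(2)]]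
      R.thCi_hom[OF f(1) g(1) Z(2)] R.thCi_hom[OF f(1) g(2) Z(2)] R.pull2_hom[OF w Z(2)]
  have eL: "ThC L f g' Z \<cdot>\<^bsub>Fib L a\<^esub> (far (Pull L f) (Pull2 L \<psi> Z \<cdot>\<^bsub>Fib L b\<^esub> l) \<cdot>\<^bsub>Fib L a\<^esub> l1) =
      Pull2 L (Hcmp2 B \<psi> (Id2 B f)) Z \<cdot>\<^bsub>Fib L a\<^esub>
        (ThC L f g Z \<cdot>\<^bsub>Fib L a\<^esub> (far (Pull L f) l \<cdot>\<^bsub>Fib L a\<^esub> l1))" (is "?x = ?y")
  proof -
    have "?x = (ThC L f g' Z \<cdot>\<^bsub>Fib L a\<^esub> far (Pull L f) (Pull2 L \<psi> Z)) \<cdot>\<^bsub>Fib L a\<^esub>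
        (far (Pull L f) l \<cdot>\<^bsub>Fib L a\<^esub> l1)"
      unfolding L.pull_comp[OF f(1) lr(1) L.pull2_hom[OF \<psi> Z(1)]]
      using tyL by (simp add: hom_def CL.calc)
    also have "\<dots> = ?y"
      unfolding L.whisker_left(1)[OF f(1) \<psi> Z(1), symmetric] using tyL by (simp add: hom_def CL.calc)
    finally show ?thesis .
  qed
  have eR: "(r1 \<cdot>\<^bsub>Fib R a\<^esub> far (Pull R f) (r \<cdot>\<^bsub>Fib R b\<^esub> Pull2 R \<psi> Z')) \<cdot>\<^bsub>Fib R a\<^esub>
        inv_ar (Fib R a) (ThC R f g Z') =
      ((r1 \<cdot>\<^bsub>Fib R a\<^esub> far (Pull R f) r) \<cdot>\<^bsub>Fib R a\<^esub> inv_ar (Fib R a) (ThC R f g' Z'))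
        \<cdot>\<^bsub>Fib R a\<^esub> Pull2 R (Hcmp2 B \<psi> (Id2 B f)) Z'" (is "?x = ?y")
  proof -
    have "?y = (r1 \<cdot>\<^bsub>Fib R a\<^esub> far (Pull R f) r) \<cdot>\<^bsub>Fib R a\<^esub>
        (inv_ar (Fib R a) (ThC R f g' Z') \<cdot>\<^bsub>Fib R a\<^esub> Pull2 R (Hcmp2 B \<psi> (Id2 B f)) Z')"
      using tyR by (simp add: hom_def CR.calc)
    also have "\<dots> = ?x"
      unfolding R.whisker_left(2)[OF f(1) \<psi> Z(2)] R.pull_comp[OF f(1) R.pull2_hom[OF \<psi> Z(2)] lr(2)]
      using tyR by (simp add: hom_def CR.calc)
    finally show ?thesis by simp
  qed
  show "(optic_comp_rep B L R S U q p, optic_comp_rep B L R S U q' p) \<in> eqv S U"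
    using comp_rep[OF S T U p qr(1)] comp_rep[OF S T U p qr(2)]
    unfolding q * optic_comp_rep_def prod.case
    by (intro eqv_stepI[OF w _ _ Z eL eR])
qed

abbreviation cls :: "'o \<times> 'x \<times> 'y \<Rightarrow> 'o \<times> 'x \<times> 'y \<Rightarrow> 'f \<times> 'm \<times> 'n \<Rightarrow> ('f \<times> 'm \<times> 'n) set" where
  "cls \<equiv> optic_class B L R"

lemma cls_eq_iff: "cls S T p = cls S T q \<longleftrightarrow> (p, q) \<in> eqv S T"
  unfolding optic_class_def eqv_def by (rule coend_class_eq_iff)

lemma mem_cls_iff: "q \<in> cls S T p \<longleftrightarrow> (p, q) \<in> eqv S T"
  by (simp add: optic_class_def eqv_def)

lemma optic_hom_iff: "q \<in> optic_hom B L R S T \<longleftrightarrow> (\<exists>p\<in>reps S T. q = cls S T p)"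
  by (auto simp: optic_hom_def coend_def quotient_def reps_def optic_class_def)

lemma hom_optic_iff:
  "F \<in> hom (optic B L R) S T \<longleftrightarrow> is_ob S \<and> is_ob T \<and> (\<exists>p\<in>reps S T. F = (S, T, cls S T p))"
  by (auto simp: hom_def optic_def Let_def is_ob_def optic_hom_iff)

lemma optic_comp_class:
  assumes S: "is_ob S" and T: "is_ob T" and U: "is_ob U" and p: "p \<in> reps S T" and q: "q \<in> reps T U"
  shows "(T, U, cls T U q) \<cdot>\<^bsub>optic B L R\<^esub> (S, T, cls S T p) =
    (S, U, cls S U (optic_comp_rep B L R S U q p))"
proof -
  have "cls S U (optic_comp_rep B L R S U q' p') = cls S U (optic_comp_rep B L R S U q p)"
    if q': "q' \<in> cls T U q" and p': "p' \<in> cls S T p" for q' p'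
  proof -
    have 1: "(p, p') \<in> eqv S T" "(q, q') \<in> eqv T U" using that by (auto simp: mem_cls_iff)
    note p'r = eqv_reps[OF S T 1(1) p]
    show ?thesis
      using comp_cong1[OF S T U 1(1) p q] comp_cong2[OF S T U 1(2) q p'r]
      unfolding cls_eq_iff[symmetric] by simp
  qed
  moreover have "q \<in> cls T U q" "p \<in> cls S T p"
    by (auto simp: mem_cls_iff eqv_def)
  ultimately have "(\<Union>q'\<in>cls T U q. \<Union>p'\<in>cls S T p. cls S U (optic_comp_rep B L R S U q' p')) =
      cls S U (optic_comp_rep B L R S U q p)"
    by blast
  then show ?thesis
    by (simp add: optic_def Let_def)
qed

lemma optic_id_class: "Idt (optic B L R) S = (S, S, cls S S (optic_id_rep B L R S))"
  by (simp add: optic_def Let_def)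

lemma comp_rep_assoc:
  assumes ob: "is_ob S" "is_ob T" "is_ob U" "is_ob V"
    and p1: "p1 \<in> reps S T" and p2: "p2 \<in> reps T U" and p3: "p3 \<in> reps U V"
  shows "(optic_comp_rep B L R S V (optic_comp_rep B L R T V p3 p2) p1,
      optic_comp_rep B L R S V p3 (optic_comp_rep B L R S U p2 p1)) \<in> eqv S V"
proof -
  obtain a X X' b Y Y' c Z Z' d W W' f l1 r1 g l2 r2 h l3 r3
    where *: "S = (a, X, X')" "T = (b, Y, Y')" "U = (c, Z, Z')" "V = (d, W, W')"
      "p1 = (f, l1, r1)" "p2 = (g, l2, r2)" "p3 = (h, l3, r3)"
    by (cases S; cases T; cases U; cases V; cases p1; cases p2; cases p3; rule that; assumption)
  have f: "f \<in> Ob (homcat B a b)" "l1 \<in> hom (Fib L a) X (fob (Pull L f) Y)"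
      "r1 \<in> hom (Fib R a) (fob (Pull R f) Y') X'"
    and g: "g \<in> Ob (homcat B b c)" "l2 \<in> hom (Fib L b) Y (fob (Pull L g) Z)"
      "r2 \<in> hom (Fib R b) (fob (Pull R g) Z') Y'"
    and h: "h \<in> Ob (homcat B c d)" "l3 \<in> hom (Fib L c) Z (fob (Pull L h) W)"
      "r3 \<in> hom (Fib R c) (fob (Pull R h) W') Z'"
    and Z: "Z \<in> Ob (Fib L c)" "Z' \<in> Ob (Fib R c)"
    and W: "W \<in> Ob (Fib L d)" "W' \<in> Ob (Fib R d)"
    using ob p1 p2 p3 by (auto simp: * reps_iff is_ob_iff)
  interpret CL: category "Fib L a" by (rule L.fib_cat(1)[OF f(1)])
  interpret CR: category "Fib R a" by (rule R.fib_cat(1)[OF f(1)])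
  interpret DL: category "Fib L b" by (rule L.fib_cat(1)[OF g(1)])
  interpret DR: category "Fib R b" by (rule R.fib_cat(1)[OF g(1)])
  note gf = L.hcmp1[OF f(1) g(1)] and hg = L.hcmp1[OF g(1) h(1)]
  note w = conjunct1[OF L.asc[OF f(1) g(1) h(1)]]
  let ?x = "Pull2 L (Asc B h g f) W" and ?x' = "Pull2 R (Asc B h g f) W'"
  note gl3 = L.pull_hom[OF g(1) h(2)] and thgh = L.thC_hom[OF g(1) h(1) W(1)]
  note gr3 = R.pull_hom[OF g(1) h(3)] and thghi = R.thCi_hom[OF g(1) h(1) W(2)]
  note tyL = f(2) L.pull_hom[OF f(1) g(2)] L.pull_hom[OF f(1) gl3] L.pull_hom[OF f(1) thgh]
      L.thC_hom[OF f(1) hg W(1)] L.thC_hom[OF gf h(1) W(1)] L.thC_hom[OF f(1) g(1) Z(1)]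
      L.thC_hom[OF f(1) g(1) L.pull_ob[OF h(1) W(1)]] L.pull_hom[OF gf h(2)] L.pull2_hom[OF w W(1)]
  note tyR = f(3) R.pull_hom[OF f(1) g(3)] R.pull_hom[OF f(1) gr3] R.pull_hom[OF f(1) thghi]
      R.thCi_hom[OF f(1) hg W(2)] R.thCi_hom[OF gf h(1) W(2)] R.thCi_hom[OF f(1) g(1) Z(2)]
      R.thCi_hom[OF f(1) g(1) R.pull_ob[OF h(1) W(2)]] R.pull_hom[OF gf h(3)] R.pull2_hom[OF w W(2)]
  have pcL: "far (Pull L f) (ThC L g h W \<cdot>\<^bsub>Fib L b\<^esub> (far (Pull L g) l3 \<cdot>\<^bsub>Fib L b\<^esub> l2)) =
      far (Pull L f) (ThC L g h W) \<cdot>\<^bsub>Fib L a\<^esub> (far (Pull L f) (far (Pull L g) l3) \<cdot>\<^bsub>Fib L a\<^esub> far (Pull L f) l2)"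
    using L.pull_comp[OF f(1) DL.comp_hom[OF g(2) gl3] thgh] L.pull_comp[OF f(1) g(2) gl3] by simp
  have pcR: "far (Pull R f) ((r2 \<cdot>\<^bsub>Fib R b\<^esub> far (Pull R g) r3) \<cdot>\<^bsub>Fib R b\<^esub> inv_ar (Fib R b) (ThC R g h W')) =
      (far (Pull R f) r2 \<cdot>\<^bsub>Fib R a\<^esub> far (Pull R f) (far (Pull R g) r3)) \<cdot>\<^bsub>Fib R a\<^esub>
        far (Pull R f) (inv_ar (Fib R b) (ThC R g h W'))"
    using R.pull_comp[OF f(1) thghi DR.comp_hom[OF gr3 g(3)]] R.pull_comp[OF f(1) gr3 g(3)] by simp
  have eL: "ThC L (Hcmp1 B g f) h W \<cdot>\<^bsub>Fib L a\<^esub> (far (Pull L (Hcmp1 B g f)) l3 \<cdot>\<^bsub>Fib L a\<^esub>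
        (ThC L f g Z \<cdot>\<^bsub>Fib L a\<^esub> (far (Pull L f) l2 \<cdot>\<^bsub>Fib L a\<^esub> l1))) =
      ?x \<cdot>\<^bsub>Fib L a\<^esub> (ThC L f (Hcmp1 B h g) W \<cdot>\<^bsub>Fib L a\<^esub>
        (far (Pull L f) (ThC L g h W \<cdot>\<^bsub>Fib L b\<^esub> (far (Pull L g) l3 \<cdot>\<^bsub>Fib L b\<^esub> l2)) \<cdot>\<^bsub>Fib L a\<^esub> l1))"
    (is "?u = ?v")
  proof -
    have "?v = (?x \<cdot>\<^bsub>Fib L a\<^esub> (ThC L f (Hcmp1 B h g) W \<cdot>\<^bsub>Fib L a\<^esub> far (Pull L f) (ThC L g h W))) \<cdot>\<^bsub>Fib L a\<^esub>
        (far (Pull L f) (far (Pull L g) l3) \<cdot>\<^bsub>Fib L a\<^esub> (far (Pull L f) l2 \<cdot>\<^bsub>Fib L a\<^esub> l1))"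
      unfolding pcL using tyL by (simp add: hom_def CL.calc)
    also have "\<dots> = ThC L (Hcmp1 B g f) h W \<cdot>\<^bsub>Fib L a\<^esub>
        ((ThC L f g (fob (Pull L h) W) \<cdot>\<^bsub>Fib L a\<^esub> far (Pull L f) (far (Pull L g) l3)) \<cdot>\<^bsub>Fib L a\<^esub>
          (far (Pull L f) l2 \<cdot>\<^bsub>Fib L a\<^esub> l1))"
      unfolding L.thC_assoc[OF f(1) g(1) h(1) W(1)] using tyL by (simp add: hom_def CL.calc)
    also have "\<dots> = ?u"
      unfolding L.thC_nat[OF f(1) g(1) h(2)] using tyL by (simp add: hom_def CL.calc)
    finally show ?thesis by simp
  qed
  have eR: "(r1 \<cdot>\<^bsub>Fib R a\<^esub> far (Pull R f) ((r2 \<cdot>\<^bsub>Fib R b\<^esub> far (Pull R g) r3) \<cdot>\<^bsub>Fib R b\<^esub>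
        inv_ar (Fib R b) (ThC R g h W'))) \<cdot>\<^bsub>Fib R a\<^esub> inv_ar (Fib R a) (ThC R f (Hcmp1 B h g) W') =
      ((((r1 \<cdot>\<^bsub>Fib R a\<^esub> far (Pull R f) r2) \<cdot>\<^bsub>Fib R a\<^esub> inv_ar (Fib R a) (ThC R f g Z')) \<cdot>\<^bsub>Fib R a\<^esub>
        far (Pull R (Hcmp1 B g f)) r3) \<cdot>\<^bsub>Fib R a\<^esub> inv_ar (Fib R a) (ThC R (Hcmp1 B g f) h W'))
        \<cdot>\<^bsub>Fib R a\<^esub> ?x'" (is "?u = ?v")
  proof -
    have "?v = (r1 \<cdot>\<^bsub>Fib R a\<^esub> far (Pull R f) r2) \<cdot>\<^bsub>Fib R a\<^esub>
        ((inv_ar (Fib R a) (ThC R f g Z') \<cdot>\<^bsub>Fib R a\<^esub> far (Pull R (Hcmp1 B g f)) r3) \<cdot>\<^bsub>Fib R a\<^esub>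
          (inv_ar (Fib R a) (ThC R (Hcmp1 B g f) h W') \<cdot>\<^bsub>Fib R a\<^esub> ?x'))"
      using tyR by (simp add: hom_def CR.calc)
    also have "\<dots> = (r1 \<cdot>\<^bsub>Fib R a\<^esub> far (Pull R f) r2) \<cdot>\<^bsub>Fib R a\<^esub>
        (far (Pull R f) (far (Pull R g) r3) \<cdot>\<^bsub>Fib R a\<^esub>
          (inv_ar (Fib R a) (ThC R f g (fob (Pull R h) W')) \<cdot>\<^bsub>Fib R a\<^esub>
            (inv_ar (Fib R a) (ThC R (Hcmp1 B g f) h W') \<cdot>\<^bsub>Fib R a\<^esub> ?x')))"
      unfolding R.thCi_nat[OF f(1) g(1) h(3)] using tyR by (simp add: hom_def CR.calc)
    also have "\<dots> = ?u"
      unfolding R.asc_right[OF f(1) g(1) h(1) W(2)] pcR using tyR by (simp add: hom_def CR.calc)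
    finally show ?thesis by simp
  qed
  show ?thesis
    using comp_rep[OF ob(1,2,4) p1 comp_rep[OF ob(2,3,4) p2 p3]]
      comp_rep[OF ob(1,3,4) comp_rep[OF ob(1,2,3) p1 p2] p3]
    unfolding * optic_comp_rep_def prod.case
    by (intro eqv_stepI[OF w _ _ W eL eR])
qed

lemma comp_rep_id_left:
  assumes ob: "is_ob S" "is_ob T" and p: "p \<in> reps S T"
  shows "(optic_comp_rep B L R S T (optic_id_rep B L R T) p, p) \<in> eqv S T"
proof -
  obtain a X X' b Y Y' f l r where *: "S = (a, X, X')" "T = (b, Y, Y')" "p = (f, l, r)"
    by (cases S; cases T; cases p; rule that; assumption)
  have f: "f \<in> Ob (homcat B a b)" "l \<in> hom (Fib L a) X (fob (Pull L f) Y)"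
      "r \<in> hom (Fib R a) (fob (Pull R f) Y') X'"
    and b: "b \<in> Ob0 B" "Y \<in> Ob (Fib L b)" "Y' \<in> Ob (Fib R b)"
    using ob p by (auto simp: * reps_iff is_ob_iff)
  interpret CL: category "Fib L a" by (rule L.fib_cat(1)[OF f(1)])
  interpret CR: category "Fib R a" by (rule R.fib_cat(1)[OF f(1)])
  note i = L.id1[OF b(1)] and w = conjunct1[OF L.lun[OF f(1)]]
  note tyL = f(2) L.pull_hom[OF f(1) L.thI_hom[OF b(1,2)]] L.thC_hom[OF f(1) i b(2)]
      L.pull2_hom[OF w b(2)]
  note tyR = f(3) R.pull_hom[OF f(1) R.thIi_hom[OF b(1,3)]] R.thCi_hom[OF f(1) i b(3)]
      R.pull2_hom[OF w b(3)]
  have eL: "l = Pull2 L (Lun B f) Y \<cdot>\<^bsub>Fib L a\<^esub>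
      (ThC L f (Id1 B b) Y \<cdot>\<^bsub>Fib L a\<^esub> (far (Pull L f) (ThI L b Y) \<cdot>\<^bsub>Fib L a\<^esub> l))" (is "_ = ?v")
  proof -
    have "?v = (Pull2 L (Lun B f) Y \<cdot>\<^bsub>Fib L a\<^esub>
        (ThC L f (Id1 B b) Y \<cdot>\<^bsub>Fib L a\<^esub> far (Pull L f) (ThI L b Y))) \<cdot>\<^bsub>Fib L a\<^esub> l"
      using tyL by (simp add: hom_def CL.calc)
    also have "\<dots> = l"
      unfolding L.thC_lun[OF f(1) b(2)] by (rule CL.id_left[OF f(2)])
    finally show ?thesis by simp
  qed
  have eR: "(r \<cdot>\<^bsub>Fib R a\<^esub> far (Pull R f) (inv_ar (Fib R b) (ThI R b Y'))) \<cdot>\<^bsub>Fib R a\<^esub>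
      inv_ar (Fib R a) (ThC R f (Id1 B b) Y') = r \<cdot>\<^bsub>Fib R a\<^esub> Pull2 R (Lun B f) Y'"
    unfolding R.lun_right[OF f(1) b(3), symmetric] using tyR by (simp add: hom_def CR.calc)
  show ?thesis
    using comp_rep[OF ob(1,2,2) p id_rep[OF ob(2)]] p
    unfolding * optic_comp_rep_def optic_id_rep_def prod.case
    by (intro eqv_stepI[OF w _ _ b(2,3) eL eR])
qed

lemma comp_rep_id_right:
  assumes ob: "is_ob S" "is_ob T" and p: "p \<in> reps S T"
  shows "(optic_comp_rep B L R S T p (optic_id_rep B L R S), p) \<in> eqv S T"
proof -
  obtain a X X' b Y Y' f l r where *: "S = (a, X, X')" "T = (b, Y, Y')" "p = (f, l, r)"
    by (cases S; cases T; cases p; rule that; assumption)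
  have f: "f \<in> Ob (homcat B a b)" "l \<in> hom (Fib L a) X (fob (Pull L f) Y)"
      "r \<in> hom (Fib R a) (fob (Pull R f) Y') X'"
    and a: "a \<in> Ob0 B" "X \<in> Ob (Fib L a)" "X' \<in> Ob (Fib R a)"
    and b: "Y \<in> Ob (Fib L b)" "Y' \<in> Ob (Fib R b)"
    using ob p by (auto simp: * reps_iff is_ob_iff)
  interpret CL: category "Fib L a" by (rule L.fib_cat(1)[OF f(1)])
  interpret CR: category "Fib R a" by (rule R.fib_cat(1)[OF f(1)])
  note i = L.id1[OF a(1)] and w = conjunct1[OF L.run[OF f(1)]]
  note tyL = f(2) L.pull_hom[OF i f(2)] L.thI_hom[OF a(1,2)] L.thC_hom[OF i f(1) b(1)]
      L.thI_hom[OF a(1) L.pull_ob[OF f(1) b(1)]] L.pull2_hom[OF w b(1)]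
  note tyR = f(3) R.pull_hom[OF i f(3)] R.thIi_hom[OF a(1,3)] R.thCi_hom[OF i f(1) b(2)]
      R.thIi_hom[OF a(1) R.pull_ob[OF f(1) b(2)]] R.pull2_hom[OF w b(2)]
  have eL: "l = Pull2 L (Run B f) Y \<cdot>\<^bsub>Fib L a\<^esub>
      (ThC L (Id1 B a) f Y \<cdot>\<^bsub>Fib L a\<^esub> (far (Pull L (Id1 B a)) l \<cdot>\<^bsub>Fib L a\<^esub> ThI L a X))" (is "_ = ?v")
  proof -
    have "?v = (Pull2 L (Run B f) Y \<cdot>\<^bsub>Fib L a\<^esub>
        (ThC L (Id1 B a) f Y \<cdot>\<^bsub>Fib L a\<^esub> ThI L a (fob (Pull L f) Y))) \<cdot>\<^bsub>Fib L a\<^esub> l"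
      unfolding L.thI_nat[OF a(1) f(2), symmetric] using tyL by (simp add: hom_def CL.calc)
    also have "\<dots> = l"
      unfolding L.thC_run[OF f(1) b(1)] by (rule CL.id_left[OF f(2)])
    finally show ?thesis by simp
  qed
  have eR: "(inv_ar (Fib R a) (ThI R a X') \<cdot>\<^bsub>Fib R a\<^esub> far (Pull R (Id1 B a)) r) \<cdot>\<^bsub>Fib R a\<^esub>
      inv_ar (Fib R a) (ThC R (Id1 B a) f Y') = r \<cdot>\<^bsub>Fib R a\<^esub> Pull2 R (Run B f) Y'"
    unfolding R.run_right[OF f(1) b(2), symmetric] R.thIi_nat[OF a(1) f(3)]
    using tyR by (simp add: hom_def CR.calc)
  show ?thesis
    using comp_rep[OF ob(1,1,2) id_rep[OF ob(1)] p] p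
    unfolding * optic_comp_rep_def optic_id_rep_def prod.case
    by (intro eqv_stepI[OF w _ _ b eL eR])
qed

theorem category_optic: "category (optic B L R)"
proof
  fix F assume "F \<in> Ar (optic B L R)"
  then show "Dom (optic B L R) F \<in> Ob (optic B L R)" "Cod (optic B L R) F \<in> Ob (optic B L R)"
    by (auto simp: optic_def Let_def)
next
  fix S assume "S \<in> Ob (optic B L R)"
  then show "Idt (optic B L R) S \<in> hom (optic B L R) S S"
    using id_rep[of S] unfolding hom_optic_iff optic_id_class is_ob_def[symmetric] by blast
next
  fix F G S T U
  assume "F \<in> hom (optic B L R) S T" "G \<in> hom (optic B L R) T U"
  then show "G \<cdot>\<^bsub>optic B L R\<^esub> F \<in> hom (optic B L R) S U"
    unfolding hom_optic_iff using optic_comp_class comp_rep by metis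
next
  fix F S T assume "F \<in> hom (optic B L R) S T"
  then obtain p where p: "is_ob S" "is_ob T" "p \<in> reps S T" "F = (S, T, cls S T p)"
    unfolding hom_optic_iff by blast
  show "Idt (optic B L R) T \<cdot>\<^bsub>optic B L R\<^esub> F = F"
    unfolding p(4) optic_id_class optic_comp_class[OF p(1,2,2,3) id_rep[OF p(2)]]
    using comp_rep_id_left[OF p(1-3)] by (simp add: cls_eq_iff)
  show "F \<cdot>\<^bsub>optic B L R\<^esub> Idt (optic B L R) S = F"
    unfolding p(4) optic_id_class optic_comp_class[OF p(1,1,2) id_rep[OF p(1)] p(3)]
    using comp_rep_id_right[OF p(1-3)] by (simp add: cls_eq_iff)
next
  fix F G H S T U V
  assume "F \<in> hom (optic B L R) S T" "G \<in> hom (optic B L R) T U" "H \<in> hom (optic B L R) U V"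
  then obtain p q r where o: "is_ob S" "is_ob T" "is_ob U" "is_ob V"
    and p: "p \<in> reps S T" "F = (S, T, cls S T p)" and q: "q \<in> reps T U" "G = (T, U, cls T U q)"
    and r: "r \<in> reps U V" "H = (U, V, cls U V r)"
    unfolding hom_optic_iff by blast
  show "H \<cdot>\<^bsub>optic B L R\<^esub> G \<cdot>\<^bsub>optic B L R\<^esub> F = H \<cdot>\<^bsub>optic B L R\<^esub> (G \<cdot>\<^bsub>optic B L R\<^esub> F)"
    unfolding p(2) q(2) r(2) optic_comp_class[OF o(2,3,4) q(1) r(1)]
      optic_comp_class[OF o(1,2,4) p(1) comp_rep[OF o(2,3,4) q(1) r(1)]]
      optic_comp_class[OF o(1,2,3) p(1) q(1)]
      optic_comp_class[OF o(1,3,4) comp_rep[OF o(1,2,3) p(1) q(1)] r(1)]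
    using comp_rep_assoc[OF o p(1) q(1) r(1)] by (simp add: cls_eq_iff)
qed

end

end

theory Submission
  imports Defs
begin

text \<open>
  Given objects \<open>(X i, X' i)\<close> over \<open>A i\<close>, let \<open>c\<close> be the coproduct of the
  \<open>A i\<close> in the bicategory. Essential surjectivity of the restriction functors of
  \<open>L\<close> and \<open>R\<close> along the \<open>\<iota> i\<close> yields an object \<open>(W, W')\<close> over
  \<open>c\<close> restricting to the given ones up to isomorphism. For optics out of
  \<open>(W, W')\<close>, essential surjectivity of precomposition with the \<open>\<iota> i\<close> and fullness
  of the restrictions give existence: every family of representatives is isomorphic to the family
  of legs of one representative. Fullness of precomposition and faithfulness of the restrictions
  show that 2-cells relating the legs of two representatives come from a single 2-cell relating
  the representatives themselves. Hence copairing respects the coend relation in each component,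
  which gives uniqueness.
\<close>

section \<open>Equivalences of categories\<close>

context category
begin

lemma iso_cancel_left:
  assumes "is_iso C f" "f \<in> hom C b c" "g \<in> hom C a b" "h \<in> hom C a b" "f \<cdot> g = f \<cdot> h"
  shows "g = h"
proof -
  note fi = inv_ar_props[OF assms(2,1)]
  have "g = inv_ar C f \<cdot> (f \<cdot> g)"
    unfolding assoc[OF assms(3,2) fi(1), symmetric] fi(2) id_left[OF assms(3)] ..
  also have "\<dots> = h"
    unfolding assms(5) assoc[OF assms(4,2) fi(1), symmetric] fi(2) id_left[OF assms(4)] ..
  finally show ?thesis .
qed

lemma iso_cancel_right:
  assumes "is_iso C f" "f \<in> hom C a b" "g \<in> hom C b c" "h \<in> hom C b c" "g \<cdot> f = h \<cdot> f"
  shows "g = h"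
proof -
  note fi = inv_ar_props[OF assms(2,1)]
  have "g = (g \<cdot> f) \<cdot> inv_ar C f"
    unfolding assoc[OF fi(1) assms(2,3)] fi(3) id_right[OF assms(3)] ..
  also have "\<dots> = h"
    unfolding assms(5) assoc[OF fi(1) assms(2,4)] fi(3) id_right[OF assms(4)] ..
  finally show ?thesis .
qed

lemma is_iso_inv_ar:
  assumes "f \<in> hom C a b" "is_iso C f"
  shows "is_iso C (inv_ar C f)"
proof -
  have "is_inverse C (inv_ar C f) f"
    using inv_ar_props[OF assms] assms(1) by (auto simp: is_inverse_def hom_def)
  then show ?thesis unfolding is_iso_def by blast
qed

end

text \<open>Naturality writes \<open>\<eta> y \<cdot> u\<close> as
  \<open>far G (far F u) \<cdot> \<eta> x\<close>, which depends on \<open>u\<close> only through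
  \<open>far F u\<close>; the isomorphism \<open>\<eta> y\<close> is then cancelled.\<close>

lemma nat_iso_from_id_faithful:
  assumes C: "category C" and \<eta>: "nat_iso C C id_fnct (comp_fnct G F) \<eta>"
    and u: "u \<in> hom C x y" and v: "v \<in> hom C x y" and eq: "far F u = far F v"
  shows "u = v"
proof -
  interpret category C by (rule C)
  have y: "y \<in> Ob C" using hom_ob[OF u] by simp
  have h: "\<eta> y \<in> hom C y (fob G (fob F y))" "is_iso C (\<eta> y)"
    using \<eta> y by (auto simp: nat_iso_def nat_trans_def id_fnct_def comp_fnct_def)
  have "\<eta> y \<cdot>\<^bsub>C\<^esub> u = \<eta> y \<cdot>\<^bsub>C\<^esub> v"
    using \<eta> u v eq by (simp add: nat_iso_def nat_trans_def id_fnct_def comp_fnct_def)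
  then show ?thesis by (rule iso_cancel_left[OF h(2,1) u v])
qed

text \<open>The same cancellation with the counit, now on the right. It shows that the quasi-inverse
  \<open>G\<close> is faithful, as the proof of fullness of \<open>F\<close> requires.\<close>

lemma nat_iso_to_id_faithful:
  assumes D: "category D" and \<epsilon>: "nat_iso D D (comp_fnct F G) id_fnct \<epsilon>"
    and u: "u \<in> hom D x y" and v: "v \<in> hom D x y" and eq: "far G u = far G v"
  shows "u = v"
proof -
  interpret category D by (rule D)
  have x: "x \<in> Ob D" using hom_ob[OF u] by simp
  have h: "\<epsilon> x \<in> hom D (fob F (fob G x)) x" "is_iso D (\<epsilon> x)"
    using \<epsilon> x by (auto simp: nat_iso_def nat_trans_def id_fnct_def comp_fnct_def)
  have "u \<cdot>\<^bsub>D\<^esub> \<epsilon> x = v \<cdot>\<^bsub>D\<^esub> \<epsilon> x"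
    using \<epsilon> u v eq unfolding nat_iso_def nat_trans_def id_fnct_def comp_fnct_def by simp metis
  then show ?thesis by (rule iso_cancel_right[OF h(2,1) u v])
qed

lemma equivalence_faithful:
  assumes "category C" "is_equivalence C D F"
    and "u \<in> hom C x y" "v \<in> hom C x y" "far F u = far F v"
  shows "u = v"
proof -
  obtain G \<eta> where "nat_iso C C id_fnct (comp_fnct G F) \<eta>"
    using assms(2) unfolding is_equivalence_def by blast
  then show ?thesis using nat_iso_from_id_faithful[OF assms(1) _ assms(3-5)] by blast
qed

lemma equivalence_full:
  assumes C: "category C" and D: "category D" and F: "is_equivalence C D F"
    and x: "x \<in> Ob C" and y: "y \<in> Ob C" and k: "k \<in> hom D (fob F x) (fob F y)"
  shows "\<exists>u\<in>hom C x y. far F u = k"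
proof -
  obtain G \<eta> \<epsilon> where fF: "is_functor C D F" and fG: "is_functor D C G"
    and \<eta>: "nat_iso C C id_fnct (comp_fnct G F) \<eta>" and \<epsilon>: "nat_iso D D (comp_fnct F G) id_fnct \<epsilon>"
    using F unfolding is_equivalence_def by blast
  interpret category C by (rule C)
  have h: "\<eta> z \<in> hom C z (fob G (fob F z))" "is_iso C (\<eta> z)" if "z \<in> Ob C" for z
    using \<eta> that by (auto simp: nat_iso_def nat_trans_def id_fnct_def comp_fnct_def)
  note yi = inv_ar_props[OF h[OF y]]
  have Gk: "far G k \<in> hom C (fob G (fob F x)) (fob G (fob F y))"
    using fG k unfolding is_functor_def by blast
  \<comment> \<open>The candidate preimage is \<open>far G k\<close> conjugated by the unit.
    Naturality gives \<open>far G (far F u) = far G k\<close>, and faithfulness of \<open>G\<close>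
    removes the outer \<open>G\<close>.\<close>
  define u where "u = inv_ar C (\<eta> y) \<cdot>\<^bsub>C\<^esub> (far G k \<cdot>\<^bsub>C\<^esub> \<eta> x)"
  note Gkx = comp_hom[OF h(1)[OF x] Gk]
  have u: "u \<in> hom C x y"
    unfolding u_def by (rule comp_hom[OF Gkx yi(1)])
  have Fu: "far F u \<in> hom D (fob F x) (fob F y)"
    using fF u unfolding is_functor_def by blast
  have GFu: "far G (far F u) \<in> hom C (fob G (fob F x)) (fob G (fob F y))"
    using fG Fu unfolding is_functor_def by blast
  have "far G (far F u) \<cdot>\<^bsub>C\<^esub> \<eta> x = \<eta> y \<cdot>\<^bsub>C\<^esub> u"
    using \<eta> u by (simp add: nat_iso_def nat_trans_def id_fnct_def comp_fnct_def)
  also have "\<dots> = far G k \<cdot>\<^bsub>C\<^esub> \<eta> x"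
    unfolding u_def using assoc[OF Gkx yi(1) h(1)[OF y]] id_left[OF Gkx] by (simp add: yi(3))
  finally have "far G (far F u) = far G k"
    by (rule iso_cancel_right[OF h(2,1)[OF x] GFu Gk])
  then have "far F u = k"
    by (rule nat_iso_to_id_faithful[OF D \<epsilon> Fu k])
  then show ?thesis using u by blast
qed

lemma equivalence_essentially_surjective:
  assumes F: "is_equivalence C D F" and y: "y \<in> Ob D"
  shows "\<exists>x\<in>Ob C. \<exists>u\<in>hom D (fob F x) y. is_iso D u"
proof -
  obtain G \<epsilon> where G: "is_functor D C G" and \<epsilon>: "nat_iso D D (comp_fnct F G) id_fnct \<epsilon>"
    using F unfolding is_equivalence_def by blast
  have "fob G y \<in> Ob C" "\<epsilon> y \<in> hom D (fob F (fob G y)) y" "is_iso D (\<epsilon> y)"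
    using G \<epsilon> y by (auto simp: is_functor_def nat_iso_def nat_trans_def id_fnct_def comp_fnct_def)
  then show ?thesis by blast
qed

section \<open>Product categories and equivalences into them\<close>

lemma hom_prod_cat_iff:
  assumes "x \<in> extensional I" "y \<in> extensional I"
  shows "u \<in> hom (prod_cat I D) x y \<longleftrightarrow> u \<in> extensional I \<and> (\<forall>i\<in>I. u i \<in> hom (D i) (x i) (y i))"
proof -
  \<comment> \<open>Endpoints in \<open>prod_cat\<close> are restrictions to \<open>I\<close>.
    Against an extensional \<open>x\<close> or \<open>y\<close>, equality of functions therefore
    amounts to equality on \<open>I\<close>.\<close>
  have "(\<lambda>i\<in>I. g i) = z \<longleftrightarrow> (\<forall>i\<in>I. g i = z i)" if "z \<in> extensional I" for g z
    using that by (auto simp: fun_eq_iff extensional_def)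
  then show ?thesis
    using assms by (auto simp: hom_def prod_cat_def PiE_def)
qed

lemma category_prod_cat:
  assumes "\<And>i. i \<in> I \<Longrightarrow> category (D i)"
  shows "category (prod_cat I D)"
proof -
  let ?P = "prod_cat I D"
  have ext: "x \<in> extensional I" if "x \<in> Ob ?P" for x
    using that by (simp add: prod_cat_def PiE_def)
  have hom: "x \<in> extensional I \<and> y \<in> extensional I \<and> u \<in> extensional I \<and>
      (\<forall>i\<in>I. u i \<in> hom (D i) (x i) (y i))" if "u \<in> hom ?P x y" for u x y
  proof -
    have "x \<in> extensional I" "y \<in> extensional I"
      using that by (auto simp: hom_def prod_cat_def)
    then show ?thesis using hom_prod_cat_iff[of x I y u D] that by simp
  qed
  have eqI: "(\<lambda>i\<in>I. g i) = z" if "z \<in> extensional I" "\<And>i. i \<in> I \<Longrightarrow> g i = z i" for g and z :: "'a \<Rightarrow> 'c"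
    using that by (auto simp: fun_eq_iff extensional_def)
  show ?thesis
  proof
    fix f assume "f \<in> Ar ?P"
    then show "Dom ?P f \<in> Ob ?P" "Cod ?P f \<in> Ob ?P"
      using category.dom_closed[OF assms] category.cod_closed[OF assms]
      by (auto simp: prod_cat_def PiE_def Pi_def)
  next
    fix a assume a: "a \<in> Ob ?P"
    then have "\<forall>i\<in>I. Idt (D i) (a i) \<in> hom (D i) (a i) (a i)"
      using category.id_hom[OF assms] by (auto simp: prod_cat_def PiE_def Pi_def)
    then show "Idt ?P a \<in> hom ?P a a"
      unfolding hom_prod_cat_iff[OF ext[OF a] ext[OF a]] by (simp add: prod_cat_def)
  next
    fix f g a b c assume f: "f \<in> hom ?P a b" and g: "g \<in> hom ?P b c"
    have ac: "a \<in> extensional I" "c \<in> extensional I" using hom[OF f] hom[OF g] by auto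
    have "\<forall>i\<in>I. g i \<cdot>\<^bsub>D i\<^esub> f i \<in> hom (D i) (a i) (c i)"
      using hom[OF f] hom[OF g] category.comp_hom[OF assms] by blast
    then show "g \<cdot>\<^bsub>?P\<^esub> f \<in> hom ?P a c"
      unfolding hom_prod_cat_iff[OF ac] by (simp add: prod_cat_def)
  next
    fix f a b assume f: "f \<in> hom ?P a b"
    then show "Idt ?P b \<cdot>\<^bsub>?P\<^esub> f = f" "f \<cdot>\<^bsub>?P\<^esub> Idt ?P a = f"
      using hom[OF f] category.id_left[OF assms] category.id_right[OF assms]
      by (auto simp: prod_cat_def intro!: eqI)
  next
    fix f g h a b c d assume f: "f \<in> hom ?P a b" and g: "g \<in> hom ?P b c" and h: "h \<in> hom ?P c d"
    have "(h i \<cdot>\<^bsub>D i\<^esub> g i) \<cdot>\<^bsub>D i\<^esub> f i = h i \<cdot>\<^bsub>D i\<^esub> (g i \<cdot>\<^bsub>D i\<^esub> f i)" if "i \<in> I" for i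
      using hom[OF f] hom[OF g] hom[OF h] category.assoc[OF assms[OF that]] that by blast
    then show "h \<cdot>\<^bsub>?P\<^esub> g \<cdot>\<^bsub>?P\<^esub> f = h \<cdot>\<^bsub>?P\<^esub> (g \<cdot>\<^bsub>?P\<^esub> f)"
      by (auto simp: prod_cat_def intro!: restrict_ext)
  qed
qed

lemma is_iso_prod_catD:
  assumes "is_iso (prod_cat I D) u" "i \<in> I"
  shows "is_iso (D i) (u i)"
proof -
  obtain w where w: "is_inverse (prod_cat I D) u w" using assms(1) unfolding is_iso_def by blast
  have "is_inverse (D i) (u i) (w i)"
    using w assms(2) unfolding is_inverse_def
    by (auto simp: prod_cat_def hom_def PiE_def Pi_def dest!: fun_cong[of _ _ i])
  then show ?thesis unfolding is_iso_def by blast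
qed

lemma functor_prod_cat_extensional:
  assumes "is_functor C (prod_cat I D) F" "x \<in> Ob C"
  shows "fob F x \<in> extensional I"
proof -
  have "fob F x \<in> Ob (prod_cat I D)" using assms unfolding is_functor_def by blast
  then show ?thesis by (simp add: prod_cat_def PiE_def)
qed

text \<open>Images in a product category are extensional, so their equality can be tested one index
  at a time. In this way equations in the fibre over a coproduct are reduced to the
  summands.\<close>

lemma prod_equivalence_faithful:
  assumes C: "category C" and F: "is_equivalence C (prod_cat I D) F"
    and u: "u \<in> hom C x y" and v: "v \<in> hom C x y" and eq: "\<And>i. i \<in> I \<Longrightarrow> far F u i = far F v i"
  shows "u = v"
proof (rule equivalence_faithful[OF C F u v])
  have "far F u \<in> hom (prod_cat I D) (fob F x) (fob F y)" "far F v \<in> hom (prod_cat I D) (fob F x) (fob F y)"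
    using F u v unfolding is_equivalence_def is_functor_def by blast+
  then have "far F u \<in> extensional I" "far F v \<in> extensional I"
    by (auto simp: hom_def prod_cat_def PiE_def)
  then show "far F u = far F v" using eq by (rule extensionalityI)
qed

lemma prod_equivalence_full:
  assumes C: "category C" and D: "\<And>i. i \<in> I \<Longrightarrow> category (D i)" and F: "is_equivalence C (prod_cat I D) F"
    and xy: "x \<in> Ob C" "y \<in> Ob C" and k: "\<And>i. i \<in> I \<Longrightarrow> k i \<in> hom (D i) (fob F x i) (fob F y i)"
  shows "\<exists>u\<in>hom C x y. \<forall>i\<in>I. far F u i = k i"
proof -
  have fF: "is_functor C (prod_cat I D) F" using F unfolding is_equivalence_def by blast
  \<comment> \<open>The values of \<open>k\<close> outside \<open>I\<close> are arbitrary, whereas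
    an arrow of \<open>prod_cat\<close> is extensional.\<close>
  have "restrict k I \<in> hom (prod_cat I D) (fob F x) (fob F y)"
    using k by (subst hom_prod_cat_iff) (auto simp: functor_prod_cat_extensional[OF fF] xy)
  then obtain u where "u \<in> hom C x y" "far F u = restrict k I"
    using equivalence_full[OF C category_prod_cat[of I D] F xy] D by blast
  then show ?thesis by (intro bexI[of _ u]) auto
qed

lemma prod_equivalence_essentially_surjective:
  assumes F: "is_equivalence C (prod_cat I D) F" and y: "\<And>i. i \<in> I \<Longrightarrow> y i \<in> Ob (D i)"
  shows "\<exists>x\<in>Ob C. \<exists>u. \<forall>i\<in>I. u i \<in> hom (D i) (fob F x i) (y i) \<and> is_iso (D i) (u i)"
proof -
  have fF: "is_functor C (prod_cat I D) F" using F unfolding is_equivalence_def by blast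
  have "restrict y I \<in> Ob (prod_cat I D)" using y by (simp add: prod_cat_def)
  then obtain x u where x: "x \<in> Ob C" and u: "u \<in> hom (prod_cat I D) (fob F x) (restrict y I)"
    and iso: "is_iso (prod_cat I D) u"
    using equivalence_essentially_surjective[OF F] by blast
  have "\<forall>i\<in>I. u i \<in> hom (D i) (fob F x i) (y i) \<and> is_iso (D i) (u i)"
    using u is_iso_prod_catD[OF iso]
      hom_prod_cat_iff[OF functor_prod_cat_extensional[OF fF x], of "restrict y I" u D]
    by auto
  then show ?thesis using x by blast
qed

section \<open>The preorder generating the coend relation\<close>

context optic_setting
begin

text \<open>A directed generator of the coend relation, with the identity actions of
  \<open>coend_step\<close> absorbed and the typing of \<open>l\<close> and \<open>r'\<close> left
  to \<open>reps\<close>. A single directed step comes with one 2-cell, which can be lifted along a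
  coproduct; a zigzag need not come from any single 2-cell.\<close>

definition refines :: "'o \<times> 'x \<times> 'y \<Rightarrow> 'o \<times> 'x \<times> 'y \<Rightarrow> 'f \<times> 'm \<times> 'n \<Rightarrow> 'f \<times> 'm \<times> 'n \<Rightarrow> bool" where
  "refines = (\<lambda>(a, X, X') (b, Y, Y') (f, l, r) (g, l', r').
     \<exists>\<phi>\<in>hom (homcat B a b) f g. l' = Pull2 L \<phi> Y \<cdot>\<^bsub>Fib L a\<^esub> l \<and> r = r' \<cdot>\<^bsub>Fib R a\<^esub> Pull2 R \<phi> Y')"

lemma refines_iff: "refines (a, X, X') (b, Y, Y') (f, l, r) (g, l', r') \<longleftrightarrow>
    (\<exists>\<phi>\<in>hom (homcat B a b) f g. l' = Pull2 L \<phi> Y \<cdot>\<^bsub>Fib L a\<^esub> l \<and> r = r' \<cdot>\<^bsub>Fib R a\<^esub> Pull2 R \<phi> Y')"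
  by (simp add: refines_def)

lemma refines_eqv:
  assumes "is_ob T" "p \<in> reps S T" "q \<in> reps S T" "refines S T p q"
  shows "(p, q) \<in> eqv S T"
proof -
  obtain a X X' b Y Y' f l r g l' r'
    where *: "S = (a, X, X')" "T = (b, Y, Y')" "p = (f, l, r)" "q = (g, l', r')"
    by (cases S; cases T; cases p; cases q; rule that; assumption)
  obtain \<phi> where "\<phi> \<in> hom (homcat B a b) f g" "l' = Pull2 L \<phi> Y \<cdot>\<^bsub>Fib L a\<^esub> l" "r = r' \<cdot>\<^bsub>Fib R a\<^esub> Pull2 R \<phi> Y'"
    using assms(4) unfolding * refines_iff by blast
  then show ?thesis
    using assms(1-3) unfolding * is_ob_iff by (intro eqv_stepI) blast+
qed

text \<open>The witness is the vertical composite of the two 2-cells; \<open>pull2_vcmp\<close>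
  turns it into a composite in the fibres.\<close>

lemma refines_trans:
  assumes "is_ob T" "p \<in> reps S T" "p'' \<in> reps S T" "refines S T p p'" "refines S T p' p''"
  shows "refines S T p p''"
proof -
  obtain a X X' b Y Y' f l r f' l' r' f'' l'' r''
    where *: "S = (a, X, X')" "T = (b, Y, Y')" "p = (f, l, r)" "p' = (f', l', r')" "p'' = (f'', l'', r'')"
    by (cases S; cases T; cases p; cases p'; cases p''; rule that; assumption)
  have Y: "Y \<in> Ob (Fib L b)" "Y' \<in> Ob (Fib R b)"
    and l: "l \<in> hom (Fib L a) X (fob (Pull L f) Y)" and r: "r'' \<in> hom (Fib R a) (fob (Pull R f'') Y') X'"
    and f: "f \<in> Ob (homcat B a b)"
    using assms(1-3) by (auto simp: * is_ob_iff reps_iff)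
  obtain \<phi> \<psi> where \<phi>: "\<phi> \<in> hom (homcat B a b) f f'" "l' = Pull2 L \<phi> Y \<cdot>\<^bsub>Fib L a\<^esub> l"
      "r = r' \<cdot>\<^bsub>Fib R a\<^esub> Pull2 R \<phi> Y'"
    and \<psi>: "\<psi> \<in> hom (homcat B a b) f' f''" "l'' = Pull2 L \<psi> Y \<cdot>\<^bsub>Fib L a\<^esub> l'"
      "r' = r'' \<cdot>\<^bsub>Fib R a\<^esub> Pull2 R \<psi> Y'"
    using assms(4,5) unfolding * refines_iff by blast
  have ab: "a \<in> Ob0 B" "b \<in> Ob0 B" using L.homcat_ob[OF f] by auto
  have "Vcmp B \<psi> \<phi> \<in> hom (homcat B a b) f f''"
    using category.comp_hom[OF L.homcat_category[OF ab] \<phi>(1) \<psi>(1)] by (simp add: homcat_def)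
  moreover have "l'' = Pull2 L (Vcmp B \<psi> \<phi>) Y \<cdot>\<^bsub>Fib L a\<^esub> l"
    unfolding L.pull2_vcmp[OF \<phi>(1) \<psi>(1) Y(1)] \<psi>(2) \<phi>(2)
    by (rule category.assoc[OF L.fib_cat(1)[OF f] l L.pull2_hom[OF \<phi>(1) Y(1)] L.pull2_hom[OF \<psi>(1) Y(1)], symmetric])
  moreover have "r = r'' \<cdot>\<^bsub>Fib R a\<^esub> Pull2 R (Vcmp B \<psi> \<phi>) Y'"
    unfolding R.pull2_vcmp[OF \<phi>(1) \<psi>(1) Y(2)] \<psi>(3) \<phi>(3)
    by (rule category.assoc[OF R.fib_cat(1)[OF f] R.pull2_hom[OF \<phi>(1) Y(2)] R.pull2_hom[OF \<psi>(1) Y(2)] r])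
  ultimately show ?thesis unfolding * refines_iff by blast
qed

lemma coend_step_refines:
  assumes "(p, q) \<in> coend_step (homcat B (fst S) (fst T)) (optic_prof L R S T)" "is_ob T"
  shows "refines S T p q"
proof -
  obtain a X X' b Y Y' where *: "S = (a, X, X')" "T = (b, Y, Y')"
    by (cases S; cases T; rule that; assumption)
  have Y: "Y \<in> Ob (Fib L b)" "Y' \<in> Ob (Fib R b)" using assms(2) by (auto simp: * is_ob_iff)
  obtain f g \<phi> l r where "\<phi> \<in> hom (homcat B a b) f g"
    "p = (f, l, r \<cdot>\<^bsub>Fib R a\<^esub> Pull2 R \<phi> Y')" "q = (g, Pull2 L \<phi> Y \<cdot>\<^bsub>Fib L a\<^esub> l, r)"
    by (rule step_cases[OF assms(1)[unfolded * fst_conv] Y])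
  then show ?thesis unfolding * by (auto simp: refines_iff)
qed

text \<open>The witness is the identity 2-cell. When one component of a family is changed, this
  relates the remaining components to themselves.\<close>

lemma refines_refl:
  assumes "is_ob T" "p \<in> reps S T"
  shows "refines S T p p"
proof -
  obtain a X X' b Y Y' f l r
    where *: "S = (a, X, X')" "T = (b, Y, Y')" "p = (f, l, r)"
    by (cases S; cases T; cases p; rule that; assumption)
  have Y: "Y \<in> Ob (Fib L b)" "Y' \<in> Ob (Fib R b)"
    and p: "f \<in> Ob (homcat B a b)" "l \<in> hom (Fib L a) X (fob (Pull L f) Y)"
      "r \<in> hom (Fib R a) (fob (Pull R f) Y') X'"
    using assms by (auto simp: * is_ob_iff reps_iff)
  show ?thesis
    unfolding * refines_iff
    by (rule bexI[OF _ L.id2_hom[OF p(1)]])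
      (simp add: L.pull2_id[OF p(1) Y(1)] R.pull2_id[OF p(1) Y(2)]
        category.id_left[OF L.fib_cat(1)[OF p(1)] p(2)] category.id_right[OF R.fib_cat(1)[OF p(1)] p(3)])
qed

end

section \<open>Optics out of a coproduct\<close>

text \<open>The isomorphisms \<open>u i\<close> and \<open>v i\<close> are oriented so that
  \<open>(\<iota> i, u i, v i)\<close> represents an optic from the \<open>i\<close>-th summand to
  the apex. The equivalences are assumed for this one cocone, so the type of indices can stay
  arbitrary.\<close>

locale optic_cocone = optic_setting B L R
  for B :: "('o, 'f, 't) bicat"
    and L :: "('o, 'f, 't, 'x, 'm) icat"
    and R :: "('o, 'f, 't, 'y, 'n) icat" +
  fixes I :: "'i set" and A :: "'i \<Rightarrow> 'o" and X :: "'i \<Rightarrow> 'x" and X' :: "'i \<Rightarrow> 'y"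
    and c :: 'o and \<iota> :: "'i \<Rightarrow> 'f" and W :: 'x and W' :: 'y and u :: "'i \<Rightarrow> 'm" and v :: "'i \<Rightarrow> 'n"
  assumes finite_index: "finite I"
    and bicoproduct: "is_bicoproduct B I A c \<iota>"
    and equivalence_L: "is_equivalence (Fib L c) (prod_cat I (\<lambda>i. Fib L (A i))) (restrict_along L I \<iota>)"
    and equivalence_R: "is_equivalence (Fib R c) (prod_cat I (\<lambda>i. Fib R (A i))) (restrict_along R I \<iota>)"
    and W: "W \<in> Ob (Fib L c)" and W': "W' \<in> Ob (Fib R c)"
    and u: "i \<in> I \<Longrightarrow> u i \<in> hom (Fib L (A i)) (X i) (fob (Pull L (\<iota> i)) W)"
    and u_iso: "i \<in> I \<Longrightarrow> is_iso (Fib L (A i)) (u i)"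
    and v: "i \<in> I \<Longrightarrow> v i \<in> hom (Fib R (A i)) (fob (Pull R (\<iota> i)) W') (X' i)"
    and v_iso: "i \<in> I \<Longrightarrow> is_iso (Fib R (A i)) (v i)"
begin

abbreviation summand :: "'i \<Rightarrow> 'o \<times> 'x \<times> 'y" where
  "summand i \<equiv> (A i, X i, X' i)"

abbreviation apex :: "'o \<times> 'x \<times> 'y" where
  "apex \<equiv> (c, W, W')"

text \<open>Composition with the injections is kept at the level of representatives, because passing
  to classes would lose the 2-cells that have to be lifted.\<close>

abbreviation leg :: "'o \<times> 'x \<times> 'y \<Rightarrow> 'f \<times> 'm \<times> 'n \<Rightarrow> 'i \<Rightarrow> 'f \<times> 'm \<times> 'n" where
  "leg T q i \<equiv> optic_comp_rep B L R (summand i) T q (\<iota> i, u i, v i)"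

lemma inclusion: "i \<in> I \<Longrightarrow> \<iota> i \<in> Ob (homcat B (A i) c)"
  and apex_base: "c \<in> Ob0 B"
  and precomp_equivalence: "d \<in> Ob0 B \<Longrightarrow>
    is_equivalence (homcat B c d) (prod_cat I (\<lambda>i. homcat B (A i) d)) (precomp B I \<iota>)"
  using bicoproduct by (auto simp: is_bicoproduct_def)

lemma summand_base: "i \<in> I \<Longrightarrow> A i \<in> Ob0 B"
  using inclusion L.homcat_ob by blast

lemma is_ob_apex: "is_ob apex"
  by (simp add: is_ob_iff apex_base W W')

lemma is_ob_summand: "i \<in> I \<Longrightarrow> is_ob (summand i)"
  using category.hom_ob[OF L.fib u] category.hom_ob[OF R.fib v]
  by (auto simp: is_ob_iff summand_base)

lemma inclusion_rep: "i \<in> I \<Longrightarrow> (\<iota> i, u i, v i) \<in> reps (summand i) apex"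
  by (simp add: reps_iff inclusion u v)

lemma leg_rep: "\<lbrakk>is_ob T; q \<in> reps apex T; i \<in> I\<rbrakk> \<Longrightarrow> leg T q i \<in> reps (summand i) T"
  using comp_rep is_ob_summand is_ob_apex inclusion_rep by blast

lemma leg_eq: "leg (d, Y, Y') (g, l, r) i = (Hcmp1 B g (\<iota> i),
    ThC L (\<iota> i) g Y \<cdot>\<^bsub>Fib L (A i)\<^esub> (far (Pull L (\<iota> i)) l \<cdot>\<^bsub>Fib L (A i)\<^esub> u i),
    (v i \<cdot>\<^bsub>Fib R (A i)\<^esub> far (Pull R (\<iota> i)) r) \<cdot>\<^bsub>Fib R (A i)\<^esub> inv_ar (Fib R (A i)) (ThC R (\<iota> i) g Y'))"
  by (simp add: optic_comp_rep_def)

text \<open>Fullness of precomposition assembles the 2-cells \<open>\<alpha> i\<close> between the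
  legs into one \<open>\<beta>\<close>. The two equations required of \<open>\<beta>\<close> are
  checked after restriction along each \<open>\<iota> i\<close>, which suffices by faithfulness;
  there they follow from the hypotheses by cancelling coherence isomorphisms, \<open>u i\<close> and
  \<open>v i\<close>.\<close>

lemma refines_if_legs_refine:
  assumes T: "is_ob T" and q: "q \<in> reps apex T" "q' \<in> reps apex T"
    and le: "\<And>i. i \<in> I \<Longrightarrow> refines (summand i) T (leg T q i) (leg T q' i)"
  shows "refines apex T q q'"
proof -
  obtain d Y Y' g l r g' l' r'
    where *: "T = (d, Y, Y')" "q = (g, l, r)" "q' = (g', l', r')"
    by (cases T; cases q; cases q'; rule that; assumption)
  have d: "d \<in> Ob0 B" and Y: "Y \<in> Ob (Fib L d)" "Y' \<in> Ob (Fib R d)"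
    and g: "g \<in> Ob (homcat B c d)" "g' \<in> Ob (homcat B c d)"
    and l: "l \<in> hom (Fib L c) W (fob (Pull L g) Y)" "l' \<in> hom (Fib L c) W (fob (Pull L g') Y)"
    and r: "r \<in> hom (Fib R c) (fob (Pull R g) Y') W'" "r' \<in> hom (Fib R c) (fob (Pull R g') Y') W'"
    using T q by (auto simp: * is_ob_iff reps_iff)
  have "\<forall>i\<in>I. \<exists>\<alpha>. \<alpha> \<in> hom (homcat B (A i) d) (Hcmp1 B g (\<iota> i)) (Hcmp1 B g' (\<iota> i)) \<and>
      ThC L (\<iota> i) g' Y \<cdot>\<^bsub>Fib L (A i)\<^esub> (far (Pull L (\<iota> i)) l' \<cdot>\<^bsub>Fib L (A i)\<^esub> u i) =
        Pull2 L \<alpha> Y \<cdot>\<^bsub>Fib L (A i)\<^esub> (ThC L (\<iota> i) g Y \<cdot>\<^bsub>Fib L (A i)\<^esub> (far (Pull L (\<iota> i)) l \<cdot>\<^bsub>Fib L (A i)\<^esub> u i)) \<and>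
      (v i \<cdot>\<^bsub>Fib R (A i)\<^esub> far (Pull R (\<iota> i)) r) \<cdot>\<^bsub>Fib R (A i)\<^esub> inv_ar (Fib R (A i)) (ThC R (\<iota> i) g Y') =
        ((v i \<cdot>\<^bsub>Fib R (A i)\<^esub> far (Pull R (\<iota> i)) r') \<cdot>\<^bsub>Fib R (A i)\<^esub> inv_ar (Fib R (A i)) (ThC R (\<iota> i) g' Y'))
          \<cdot>\<^bsub>Fib R (A i)\<^esub> Pull2 R \<alpha> Y'"
    using le unfolding * leg_eq refines_iff by blast
  then obtain \<alpha> where \<alpha>: "\<And>i. i \<in> I \<Longrightarrow> \<alpha> i \<in> hom (homcat B (A i) d) (Hcmp1 B g (\<iota> i)) (Hcmp1 B g' (\<iota> i))"
    and \<alpha>L: "\<And>i. i \<in> I \<Longrightarrow> ThC L (\<iota> i) g' Y \<cdot>\<^bsub>Fib L (A i)\<^esub> (far (Pull L (\<iota> i)) l' \<cdot>\<^bsub>Fib L (A i)\<^esub> u i) =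
        Pull2 L (\<alpha> i) Y \<cdot>\<^bsub>Fib L (A i)\<^esub> (ThC L (\<iota> i) g Y \<cdot>\<^bsub>Fib L (A i)\<^esub> (far (Pull L (\<iota> i)) l \<cdot>\<^bsub>Fib L (A i)\<^esub> u i))"
    and \<alpha>R: "\<And>i. i \<in> I \<Longrightarrow>
      (v i \<cdot>\<^bsub>Fib R (A i)\<^esub> far (Pull R (\<iota> i)) r) \<cdot>\<^bsub>Fib R (A i)\<^esub> inv_ar (Fib R (A i)) (ThC R (\<iota> i) g Y') =
        ((v i \<cdot>\<^bsub>Fib R (A i)\<^esub> far (Pull R (\<iota> i)) r') \<cdot>\<^bsub>Fib R (A i)\<^esub> inv_ar (Fib R (A i)) (ThC R (\<iota> i) g' Y'))
          \<cdot>\<^bsub>Fib R (A i)\<^esub> Pull2 R (\<alpha> i) Y'"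
    unfolding bchoice_iff by blast
  obtain \<beta> where \<beta>: "\<beta> \<in> hom (homcat B c d) g g'"
    and \<beta>': "\<And>i. i \<in> I \<Longrightarrow> far (precomp B I \<iota>) \<beta> i = \<alpha> i"
  proof -
    have "\<exists>\<beta>\<in>hom (homcat B c d) g g'. \<forall>i\<in>I. far (precomp B I \<iota>) \<beta> i = \<alpha> i"
    proof (rule prod_equivalence_full[OF _ _ precomp_equivalence[OF d] g])
      show "category (homcat B c d)" "\<And>i. i \<in> I \<Longrightarrow> category (homcat B (A i) d)"
        using L.homcat_category apex_base summand_base d by auto
      show "\<alpha> i \<in> hom (homcat B (A i) d) (fob (precomp B I \<iota>) g i) (fob (precomp B I \<iota>) g' i)"
        if "i \<in> I" for i
        using \<alpha>[OF that] that by (simp add: precomp_def)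
    qed
    then show thesis using that by blast
  qed
  have whisker: "\<alpha> i = Hcmp2 B \<beta> (Id2 B (\<iota> i))" if "i \<in> I" for i
    using \<beta>'[OF that] that by (simp add: precomp_def)
  note \<beta>L = L.pull2_hom[OF \<beta> Y(1)] and \<beta>R = R.pull2_hom[OF \<beta> Y(2)]
  note cL = L.fib[OF apex_base] and cR = R.fib[OF apex_base]
  have eL: "l' = Pull2 L \<beta> Y \<cdot>\<^bsub>Fib L c\<^esub> l"
  proof (rule prod_equivalence_faithful[OF cL equivalence_L l(2) category.comp_hom[OF cL l(1) \<beta>L]])
    fix i assume i: "i \<in> I"
    note \<iota> = inclusion[OF i]
    interpret C: category "Fib L (A i)" using L.fib_cat(1)[OF \<iota>] .
    note th = L.thC_hom[OF \<iota> g(1) Y(1)] and th' = L.thC_hom[OF \<iota> g(2) Y(1)]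
    note ty = u[OF i] L.pull_hom[OF \<iota> l(1)] L.pull_hom[OF \<iota> l(2)] L.pull_hom[OF \<iota> \<beta>L] th th'
      L.pull2_hom[OF \<alpha>[OF i] Y(1)]
    note pc = L.pull_comp[OF \<iota> l(1) \<beta>L]
    have "ThC L (\<iota> i) g' Y \<cdot>\<^bsub>Fib L (A i)\<^esub> (far (Pull L (\<iota> i)) l' \<cdot>\<^bsub>Fib L (A i)\<^esub> u i) =
        (Pull2 L (\<alpha> i) Y \<cdot>\<^bsub>Fib L (A i)\<^esub> ThC L (\<iota> i) g Y) \<cdot>\<^bsub>Fib L (A i)\<^esub> (far (Pull L (\<iota> i)) l \<cdot>\<^bsub>Fib L (A i)\<^esub> u i)"
      unfolding \<alpha>L[OF i] using ty by (simp add: hom_def C.calc)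
    \<comment> \<open>Since \<open>\<alpha> i\<close> is \<open>\<beta>\<close> whiskered with
      \<open>\<iota> i\<close>, it can be moved past \<open>ThC\<close>. It then becomes the
      pullback of a component of \<open>\<beta>\<close> and merges with \<open>l\<close> by
      functoriality.\<close>
    also have "\<dots> = ThC L (\<iota> i) g' Y \<cdot>\<^bsub>Fib L (A i)\<^esub>
        (far (Pull L (\<iota> i)) (Pull2 L \<beta> Y \<cdot>\<^bsub>Fib L c\<^esub> l) \<cdot>\<^bsub>Fib L (A i)\<^esub> u i)"
      unfolding whisker[OF i] L.whisker_left(1)[OF \<iota> \<beta> Y(1)] pc
      using ty by (simp add: hom_def C.calc)
    finally have "far (Pull L (\<iota> i)) l' \<cdot>\<^bsub>Fib L (A i)\<^esub> u i =
        far (Pull L (\<iota> i)) (Pull2 L \<beta> Y \<cdot>\<^bsub>Fib L c\<^esub> l) \<cdot>\<^bsub>Fib L (A i)\<^esub> u i"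
      by (rule C.iso_cancel_left[OF L.thC_iso[OF \<iota> g(2) Y(1)] th', rotated 2])
        (use u[OF i] L.pull_hom[OF \<iota>] l category.comp_hom[OF cL l(1) \<beta>L] in \<open>blast intro: C.comp_hom\<close>)+
    then have "far (Pull L (\<iota> i)) l' = far (Pull L (\<iota> i)) (Pull2 L \<beta> Y \<cdot>\<^bsub>Fib L c\<^esub> l)"
      by (rule C.iso_cancel_right[OF u_iso[OF i] u[OF i] L.pull_hom[OF \<iota> l(2)]
            L.pull_hom[OF \<iota> category.comp_hom[OF cL l(1) \<beta>L]]])
    then show "far (restrict_along L I \<iota>) l' i = far (restrict_along L I \<iota>) (Pull2 L \<beta> Y \<cdot>\<^bsub>Fib L c\<^esub> l) i"
      using i by (simp add: restrict_along_def)
  qed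
  \<comment> \<open>On the \<open>R\<close> side arrows run the other way: the 2-cell acts before
    \<open>r'\<close>, and the coherence isomorphism occurs inverted and is cancelled on the
    right.\<close>
  have eR: "r = r' \<cdot>\<^bsub>Fib R c\<^esub> Pull2 R \<beta> Y'"
  proof (rule prod_equivalence_faithful[OF cR equivalence_R r(1) category.comp_hom[OF cR \<beta>R r(2)]])
    fix i assume i: "i \<in> I"
    note \<iota> = inclusion[OF i]
    interpret C: category "Fib R (A i)" using R.fib_cat(1)[OF \<iota>] .
    let ?t = "inv_ar (Fib R (A i)) (ThC R (\<iota> i) g Y')" and ?t' = "inv_ar (Fib R (A i)) (ThC R (\<iota> i) g' Y')"
    note th = R.thCi_hom[OF \<iota> g(1) Y(2)] and th' = R.thCi_hom[OF \<iota> g(2) Y(2)]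
    note ty = v[OF i] R.pull_hom[OF \<iota> r(1)] R.pull_hom[OF \<iota> r(2)] R.pull_hom[OF \<iota> \<beta>R] th th'
      R.pull2_hom[OF \<alpha>[OF i] Y(2)]
    note pc = R.pull_comp[OF \<iota> \<beta>R r(2)]
    have "(v i \<cdot>\<^bsub>Fib R (A i)\<^esub> far (Pull R (\<iota> i)) r) \<cdot>\<^bsub>Fib R (A i)\<^esub> ?t =
        (v i \<cdot>\<^bsub>Fib R (A i)\<^esub> far (Pull R (\<iota> i)) r') \<cdot>\<^bsub>Fib R (A i)\<^esub> (?t' \<cdot>\<^bsub>Fib R (A i)\<^esub> Pull2 R (\<alpha> i) Y')"
      unfolding \<alpha>R[OF i] using ty by (simp add: hom_def C.calc)
    also have "\<dots> = (v i \<cdot>\<^bsub>Fib R (A i)\<^esub> far (Pull R (\<iota> i)) (r' \<cdot>\<^bsub>Fib R c\<^esub> Pull2 R \<beta> Y')) \<cdot>\<^bsub>Fib R (A i)\<^esub> ?t"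
      unfolding whisker[OF i] R.whisker_left(2)[OF \<iota> \<beta> Y(2)] pc
      using ty by (simp add: hom_def C.calc)
    finally have eq: "(v i \<cdot>\<^bsub>Fib R (A i)\<^esub> far (Pull R (\<iota> i)) r) \<cdot>\<^bsub>Fib R (A i)\<^esub> ?t =
        (v i \<cdot>\<^bsub>Fib R (A i)\<^esub> far (Pull R (\<iota> i)) (r' \<cdot>\<^bsub>Fib R c\<^esub> Pull2 R \<beta> Y')) \<cdot>\<^bsub>Fib R (A i)\<^esub> ?t" .
    note h1 = R.pull_hom[OF \<iota> r(1)] and h2 = R.pull_hom[OF \<iota> category.comp_hom[OF cR \<beta>R r(2)]]
    have "v i \<cdot>\<^bsub>Fib R (A i)\<^esub> far (Pull R (\<iota> i)) r =
        v i \<cdot>\<^bsub>Fib R (A i)\<^esub> far (Pull R (\<iota> i)) (r' \<cdot>\<^bsub>Fib R c\<^esub> Pull2 R \<beta> Y')"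
      by (rule C.iso_cancel_right[OF C.is_iso_inv_ar[OF R.thC_hom[OF \<iota> g(1) Y(2)] R.thC_iso[OF \<iota> g(1) Y(2)]] th
            C.comp_hom[OF h1 v[OF i]] C.comp_hom[OF h2 v[OF i]] eq])
    then have "far (Pull R (\<iota> i)) r = far (Pull R (\<iota> i)) (r' \<cdot>\<^bsub>Fib R c\<^esub> Pull2 R \<beta> Y')"
      by (rule C.iso_cancel_left[OF v_iso[OF i] v[OF i] h1 h2])
    then show "far (restrict_along R I \<iota>) r i = far (restrict_along R I \<iota>) (r' \<cdot>\<^bsub>Fib R c\<^esub> Pull2 R \<beta> Y') i"
      using i by (simp add: restrict_along_def)
  qed
  show ?thesis unfolding * refines_iff using \<beta> eL eR by blast
qed

text \<open>Essential surjectivity of precomposition supplies a 1-cell \<open>g\<close> with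
  invertible 2-cells \<open>\<phi> i\<close> from its restrictions to the \<open>f i\<close>. The
  arrows are transported along these, and fullness of the two restrictions lifts the results to
  \<open>c\<close>. Invertibility of \<open>\<phi> i\<close> gives the refinements in both
  directions.\<close>

lemma ex_copairing:
  assumes T: "is_ob T" and p: "\<And>i. i \<in> I \<Longrightarrow> p i \<in> reps (summand i) T"
  obtains q where "q \<in> reps apex T" "\<And>i. i \<in> I \<Longrightarrow> refines (summand i) T (p i) (leg T q i)"
    "\<And>i. i \<in> I \<Longrightarrow> refines (summand i) T (leg T q i) (p i)"
proof -
  obtain d Y Y' where *: "T = (d, Y, Y')" by (cases T)
  define f where "f i = fst (p i)" for i
  define l where "l i = fst (snd (p i))" for i
  define r where "r i = snd (snd (p i))" for i
  have p_eq: "p i = (f i, l i, r i)" for i by (simp add: f_def l_def r_def)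
  have d: "d \<in> Ob0 B" and Y: "Y \<in> Ob (Fib L d)" "Y' \<in> Ob (Fib R d)"
    using T by (auto simp: * is_ob_iff)
  have f: "f i \<in> Ob (homcat B (A i) d)" and l: "l i \<in> hom (Fib L (A i)) (X i) (fob (Pull L (f i)) Y)"
    and r: "r i \<in> hom (Fib R (A i)) (fob (Pull R (f i)) Y') (X' i)" if "i \<in> I" for i
    using p[OF that] by (auto simp: * p_eq reps_iff)
  obtain g \<phi> where g: "g \<in> Ob (homcat B c d)"
    and \<phi>: "\<And>i. i \<in> I \<Longrightarrow> \<phi> i \<in> hom (homcat B (A i) d) (fob (precomp B I \<iota>) g i) (f i)"
    and \<phi>_iso: "\<And>i. i \<in> I \<Longrightarrow> is_iso (homcat B (A i) d) (\<phi> i)"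
    using prod_equivalence_essentially_surjective[OF precomp_equivalence[OF d] f] by blast
  define \<psi> where "\<psi> i = inv_ar (homcat B (A i) d) (\<phi> i)" for i
  have \<phi>: "\<phi> i \<in> hom (homcat B (A i) d) (Hcmp1 B g (\<iota> i)) (f i)" if "i \<in> I" for i
    using \<phi>[OF that] that by (simp add: precomp_def)
  have \<psi>: "\<psi> i \<in> hom (homcat B (A i) d) (f i) (Hcmp1 B g (\<iota> i))"
    "Vcmp B (\<psi> i) (\<phi> i) = Id2 B (Hcmp1 B g (\<iota> i))" "Vcmp B (\<phi> i) (\<psi> i) = Id2 B (f i)" if "i \<in> I" for i
    using category.inv_ar_props[OF L.homcat_category \<phi> \<phi>_iso, OF summand_base[OF that] d that that]
    unfolding \<psi>_def by (simp_all add: homcat_def)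
  \<comment> \<open>\<open>k\<close> and \<open>k'\<close> solve the formula \<open>leg_eq\<close>
    for the restricted arrows, so that the legs become \<open>l i\<close> transported along
    \<open>\<psi> i\<close> and \<open>r i\<close> transported along
    \<open>\<phi> i\<close>.\<close>
  define k where "k i = inv_ar (Fib L (A i)) (ThC L (\<iota> i) g Y) \<cdot>\<^bsub>Fib L (A i)\<^esub>
    ((Pull2 L (\<psi> i) Y \<cdot>\<^bsub>Fib L (A i)\<^esub> l i) \<cdot>\<^bsub>Fib L (A i)\<^esub> inv_ar (Fib L (A i)) (u i))" for i
  define k' where "k' i = inv_ar (Fib R (A i)) (v i) \<cdot>\<^bsub>Fib R (A i)\<^esub>
    ((r i \<cdot>\<^bsub>Fib R (A i)\<^esub> Pull2 R (\<phi> i) Y') \<cdot>\<^bsub>Fib R (A i)\<^esub> ThC R (\<iota> i) g Y')" for i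
  have k: "k i \<in> hom (Fib L (A i)) (fob (Pull L (\<iota> i)) W) (fob (Pull L (\<iota> i)) (fob (Pull L g) Y))"
    and k_eq: "ThC L (\<iota> i) g Y \<cdot>\<^bsub>Fib L (A i)\<^esub> (k i \<cdot>\<^bsub>Fib L (A i)\<^esub> u i) = Pull2 L (\<psi> i) Y \<cdot>\<^bsub>Fib L (A i)\<^esub> l i"
    and \<phi>l: "Pull2 L (\<phi> i) Y \<cdot>\<^bsub>Fib L (A i)\<^esub> (Pull2 L (\<psi> i) Y \<cdot>\<^bsub>Fib L (A i)\<^esub> l i) = l i"
    if i: "i \<in> I" for i
  proof -
    note \<iota> = inclusion[OF i]
    interpret C: category "Fib L (A i)" using L.fib_cat(1)[OF \<iota>] .
    note th = L.thC_hom[OF \<iota> g Y(1)]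
    note thi = C.inv_ar_props[OF th L.thC_iso[OF \<iota> g Y(1)]] and ui = C.inv_ar_props[OF u[OF i] u_iso[OF i]]
    note ty = u[OF i] l[OF i] th thi(1) ui(1) L.pull2_hom[OF \<psi>(1)[OF i] Y(1)] L.pull2_hom[OF \<phi>[OF i] Y(1)]
    show "k i \<in> hom (Fib L (A i)) (fob (Pull L (\<iota> i)) W) (fob (Pull L (\<iota> i)) (fob (Pull L g) Y))"
      unfolding k_def using ty by (simp add: hom_def C.calc)
    have "ThC L (\<iota> i) g Y \<cdot>\<^bsub>Fib L (A i)\<^esub> (k i \<cdot>\<^bsub>Fib L (A i)\<^esub> u i) =
      (ThC L (\<iota> i) g Y \<cdot>\<^bsub>Fib L (A i)\<^esub> inv_ar (Fib L (A i)) (ThC L (\<iota> i) g Y)) \<cdot>\<^bsub>Fib L (A i)\<^esub>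
      ((Pull2 L (\<psi> i) Y \<cdot>\<^bsub>Fib L (A i)\<^esub> l i) \<cdot>\<^bsub>Fib L (A i)\<^esub> (inv_ar (Fib L (A i)) (u i) \<cdot>\<^bsub>Fib L (A i)\<^esub> u i))"
      unfolding k_def using ty by (simp add: hom_def C.calc)
    also have "\<dots> = Pull2 L (\<psi> i) Y \<cdot>\<^bsub>Fib L (A i)\<^esub> l i"
      unfolding thi(3) ui(2) using ty C.hom_ob[OF u[OF i]] C.hom_ob[OF th] by (simp add: hom_def C.calc)
    finally show "ThC L (\<iota> i) g Y \<cdot>\<^bsub>Fib L (A i)\<^esub> (k i \<cdot>\<^bsub>Fib L (A i)\<^esub> u i) = Pull2 L (\<psi> i) Y \<cdot>\<^bsub>Fib L (A i)\<^esub> l i" .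
    have "Pull2 L (\<phi> i) Y \<cdot>\<^bsub>Fib L (A i)\<^esub> (Pull2 L (\<psi> i) Y \<cdot>\<^bsub>Fib L (A i)\<^esub> l i) = Pull2 L (Vcmp B (\<phi> i) (\<psi> i)) Y \<cdot>\<^bsub>Fib L (A i)\<^esub> l i"
      unfolding L.pull2_vcmp[OF \<psi>(1)[OF i] \<phi>[OF i] Y(1)] using ty by (simp add: hom_def C.calc)
    then show "Pull2 L (\<phi> i) Y \<cdot>\<^bsub>Fib L (A i)\<^esub> (Pull2 L (\<psi> i) Y \<cdot>\<^bsub>Fib L (A i)\<^esub> l i) = l i"
      unfolding \<psi>(3)[OF i] L.pull2_id[OF f[OF i] Y(1)] using C.id_left[OF l[OF i]] by simp
  qed
  have k': "k' i \<in> hom (Fib R (A i)) (fob (Pull R (\<iota> i)) (fob (Pull R g) Y')) (fob (Pull R (\<iota> i)) W')"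
    and k'_eq: "(v i \<cdot>\<^bsub>Fib R (A i)\<^esub> k' i) \<cdot>\<^bsub>Fib R (A i)\<^esub> inv_ar (Fib R (A i)) (ThC R (\<iota> i) g Y') =
      r i \<cdot>\<^bsub>Fib R (A i)\<^esub> Pull2 R (\<phi> i) Y'"
    and \<psi>r: "(r i \<cdot>\<^bsub>Fib R (A i)\<^esub> Pull2 R (\<phi> i) Y') \<cdot>\<^bsub>Fib R (A i)\<^esub> Pull2 R (\<psi> i) Y' = r i"
    if i: "i \<in> I" for i
  proof -
    note \<iota> = inclusion[OF i]
    interpret C: category "Fib R (A i)" using R.fib_cat(1)[OF \<iota>] .
    note th = R.thC_hom[OF \<iota> g Y(2)]
    note thi = C.inv_ar_props[OF th R.thC_iso[OF \<iota> g Y(2)]] and vi = C.inv_ar_props[OF v[OF i] v_iso[OF i]]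
    note ty = v[OF i] r[OF i] th thi(1) vi(1) R.pull2_hom[OF \<psi>(1)[OF i] Y(2)] R.pull2_hom[OF \<phi>[OF i] Y(2)]
    show "k' i \<in> hom (Fib R (A i)) (fob (Pull R (\<iota> i)) (fob (Pull R g) Y')) (fob (Pull R (\<iota> i)) W')"
      unfolding k'_def using ty by (simp add: hom_def C.calc)
    have "(v i \<cdot>\<^bsub>Fib R (A i)\<^esub> k' i) \<cdot>\<^bsub>Fib R (A i)\<^esub> inv_ar (Fib R (A i)) (ThC R (\<iota> i) g Y') =
      (v i \<cdot>\<^bsub>Fib R (A i)\<^esub> inv_ar (Fib R (A i)) (v i)) \<cdot>\<^bsub>Fib R (A i)\<^esub> ((r i \<cdot>\<^bsub>Fib R (A i)\<^esub> Pull2 R (\<phi> i) Y')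
        \<cdot>\<^bsub>Fib R (A i)\<^esub> (ThC R (\<iota> i) g Y' \<cdot>\<^bsub>Fib R (A i)\<^esub> inv_ar (Fib R (A i)) (ThC R (\<iota> i) g Y')))"
      unfolding k'_def using ty by (simp add: hom_def C.calc)
    also have "\<dots> = r i \<cdot>\<^bsub>Fib R (A i)\<^esub> Pull2 R (\<phi> i) Y'"
      unfolding thi(3) vi(3) using ty C.hom_ob[OF v[OF i]] C.hom_ob[OF th] by (simp add: hom_def C.calc)
    finally show "(v i \<cdot>\<^bsub>Fib R (A i)\<^esub> k' i) \<cdot>\<^bsub>Fib R (A i)\<^esub> inv_ar (Fib R (A i)) (ThC R (\<iota> i) g Y') =
      r i \<cdot>\<^bsub>Fib R (A i)\<^esub> Pull2 R (\<phi> i) Y'" .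
    have "(r i \<cdot>\<^bsub>Fib R (A i)\<^esub> Pull2 R (\<phi> i) Y') \<cdot>\<^bsub>Fib R (A i)\<^esub> Pull2 R (\<psi> i) Y' =
        r i \<cdot>\<^bsub>Fib R (A i)\<^esub> Pull2 R (Vcmp B (\<phi> i) (\<psi> i)) Y'"
      unfolding R.pull2_vcmp[OF \<psi>(1)[OF i] \<phi>[OF i] Y(2)] using ty by (simp add: hom_def C.calc)
    then show "(r i \<cdot>\<^bsub>Fib R (A i)\<^esub> Pull2 R (\<phi> i) Y') \<cdot>\<^bsub>Fib R (A i)\<^esub> Pull2 R (\<psi> i) Y' = r i"
      unfolding \<psi>(3)[OF i] R.pull2_id[OF f[OF i] Y(2)] using C.id_right[OF r[OF i]] by simp
  qed
  have "\<exists>m\<in>hom (Fib L c) W (fob (Pull L g) Y). \<forall>i\<in>I. far (restrict_along L I \<iota>) m i = k i"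
    by (rule prod_equivalence_full[OF L.fib[OF apex_base] L.fib[OF summand_base] equivalence_L W L.pull_ob[OF g Y(1)]])
      (use k in \<open>auto simp: restrict_along_def\<close>)
  then obtain m where m: "m \<in> hom (Fib L c) W (fob (Pull L g) Y)"
    and m_eq: "\<And>i. i \<in> I \<Longrightarrow> far (restrict_along L I \<iota>) m i = k i"
    by blast
  have "\<exists>n\<in>hom (Fib R c) (fob (Pull R g) Y') W'. \<forall>i\<in>I. far (restrict_along R I \<iota>) n i = k' i"
    by (rule prod_equivalence_full[OF R.fib[OF apex_base] R.fib[OF summand_base] equivalence_R R.pull_ob[OF g Y(2)] W'])
      (use k' in \<open>auto simp: restrict_along_def\<close>)
  then obtain n where n: "n \<in> hom (Fib R c) (fob (Pull R g) Y') W'"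
    and n_eq: "\<And>i. i \<in> I \<Longrightarrow> far (restrict_along R I \<iota>) n i = k' i"
    by blast
  have leg: "leg T (g, m, n) i = (Hcmp1 B g (\<iota> i), Pull2 L (\<psi> i) Y \<cdot>\<^bsub>Fib L (A i)\<^esub> l i,
      r i \<cdot>\<^bsub>Fib R (A i)\<^esub> Pull2 R (\<phi> i) Y')" if "i \<in> I" for i
    using m_eq[OF that] n_eq[OF that] k_eq[OF that] k'_eq[OF that] that
    unfolding * leg_eq by (simp add: restrict_along_def)
  show thesis
  proof (rule that)
    show "(g, m, n) \<in> reps apex T" unfolding * reps_iff using g m n by blast
    \<comment> \<open>For \<open>\<psi> i\<close> the left equation is immediate and the right one
      is \<open>\<psi>r\<close>; for \<open>\<phi> i\<close> below, the right equation is immediate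
      and the left one is \<open>\<phi>l\<close>.\<close>
    show "refines (summand i) T (p i) (leg T (g, m, n) i)" if "i \<in> I" for i
      unfolding leg[OF that] p_eq unfolding * refines_iff
      using \<psi>(1)[OF that] \<psi>r[OF that] by (intro bexI[of _ "\<psi> i"]) auto
    show "refines (summand i) T (leg T (g, m, n) i) (p i)" if "i \<in> I" for i
      unfolding leg[OF that] p_eq unfolding * refines_iff
      using \<phi>[OF that] \<phi>l[OF that] by (intro bexI[of _ "\<phi> i"]) auto
  qed
qed

section \<open>Copairing and its invariance under the coend relation\<close>

definition copairing :: "'o \<times> 'x \<times> 'y \<Rightarrow> ('i \<Rightarrow> 'f \<times> 'm \<times> 'n) \<Rightarrow> 'f \<times> 'm \<times> 'n" where
  "copairing T p = (SOME q. q \<in> reps apex T \<and> (\<forall>i\<in>I. refines (summand i) T (p i) (leg T q i) \<and>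
     refines (summand i) T (leg T q i) (p i)))"

text \<open>The 1-cell in \<open>ex_copairing\<close> comes from essential surjectivity, hence
  without a canonical choice. Later arguments rely on these three properties alone.\<close>

lemma copairing:
  assumes "is_ob T" "\<And>i. i \<in> I \<Longrightarrow> p i \<in> reps (summand i) T"
  shows "copairing T p \<in> reps apex T"
    and "i \<in> I \<Longrightarrow> refines (summand i) T (p i) (leg T (copairing T p) i)"
    and "i \<in> I \<Longrightarrow> refines (summand i) T (leg T (copairing T p) i) (p i)"
proof -
  have "\<exists>q. q \<in> reps apex T \<and> (\<forall>i\<in>I. refines (summand i) T (p i) (leg T q i) \<and>
     refines (summand i) T (leg T q i) (p i))"
    using ex_copairing[OF assms, of thesis for thesis] by metis
  from someI_ex[OF this, folded copairing_def]
  show "copairing T p \<in> reps apex T"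
    and "i \<in> I \<Longrightarrow> refines (summand i) T (p i) (leg T (copairing T p) i)"
    and "i \<in> I \<Longrightarrow> refines (summand i) T (leg T (copairing T p) i) (p i)" by blast+
qed

text \<open>At each index the leg of \<open>copairing T p\<close> refines \<open>p i\<close>, which
  refines \<open>q i\<close>, which refines the leg of \<open>copairing T q\<close>. All indices use
  the same direction, so \<open>refines_if_legs_refine\<close> applies.\<close>

lemma copairing_refines:
  assumes T: "is_ob T" and p: "\<And>i. i \<in> I \<Longrightarrow> p i \<in> reps (summand i) T"
    and q: "\<And>i. i \<in> I \<Longrightarrow> q i \<in> reps (summand i) T"
    and le: "\<And>i. i \<in> I \<Longrightarrow> refines (summand i) T (p i) (q i)"
  shows "(copairing T p, copairing T q) \<in> eqv apex T"
proof (rule refines_eqv[OF T copairing(1)[OF T p] copairing(1)[OF T q]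
      refines_if_legs_refine[OF T copairing(1)[OF T p] copairing(1)[OF T q]]])
  fix i assume i: "i \<in> I"
  let ?P = "leg T (copairing T p) i" and ?Q = "leg T (copairing T q) i"
  have P: "?P \<in> reps (summand i) T" by (rule leg_rep[OF T copairing(1)[OF T p] i])
  have Q: "?Q \<in> reps (summand i) T" by (rule leg_rep[OF T copairing(1)[OF T q] i])
  have "refines (summand i) T ?P (q i)"
    by (rule refines_trans[OF T P q[OF i] copairing(3)[OF T p i] le[OF i]])
  then show "refines (summand i) T ?P ?Q"
    by (rule refines_trans[OF T P Q _ copairing(2)[OF T q i]])
qed

text \<open>It suffices to treat one generating step in component \<open>j\<close>: the new families
  are related by that step at \<open>j\<close> and by reflexivity elsewhere. Reversed steps are
  covered by symmetry in \<open>eqv_invariant\<close>.\<close>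

lemma copairing_update:
  assumes T: "is_ob T" and p: "\<And>i. i \<in> I \<Longrightarrow> p i \<in> reps (summand i) T"
    and j: "j \<in> I" and y: "(y, z) \<in> eqv (summand j) T" "y \<in> reps (summand j) T"
  shows "(copairing T (p(j := y)), copairing T (p(j := z))) \<in> eqv apex T"
proof (rule eqv_invariant[OF y is_ob_summand[OF j] T])
  fix y z assume yz: "(y, z) \<in> coend_step (homcat B (fst (summand j)) (fst T)) (optic_prof L R (summand j) T)"
    and r: "y \<in> reps (summand j) T" "z \<in> reps (summand j) T"
  show "(copairing T (p(j := y)), copairing T (p(j := z))) \<in> eqv apex T"
    using p r coend_step_refines[OF yz T] refines_refl[OF T p] by (intro copairing_refines[OF T]) auto
qed

text \<open>
  The zigzags relating \<open>p i\<close> to \<open>q i\<close> for different \<open>i\<close> have unrelated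
  shapes, so the components are changed one at a time; here finiteness of the index set is used.
\<close>

lemma copairing_cong:
  assumes T: "is_ob T" and p: "\<And>i. i \<in> I \<Longrightarrow> p i \<in> reps (summand i) T"
    and eq: "\<And>i. i \<in> I \<Longrightarrow> (p i, q i) \<in> eqv (summand i) T"
  shows "(copairing T p, copairing T q) \<in> eqv apex T"
proof -
  have q: "q i \<in> reps (summand i) T" if "i \<in> I" for i
    using eqv_reps[OF is_ob_summand[OF that] T eq[OF that] p[OF that]] .
  have "(copairing T p, copairing T (\<lambda>i. if i \<in> J then q i else p i)) \<in> eqv apex T"
    if "finite J" "J \<subseteq> I" for J
    using that
  proof (induction J rule: finite_induct)
    case empty
    then show ?case by (simp add: eqv_def)
  next
    case (insert j J)
    let ?m = "\<lambda>i. if i \<in> J then q i else p i"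
    \<comment> \<open>As \<open>j\<close> is not in \<open>J\<close>, the interpolating family still
      has the value \<open>p j\<close> there, so passing to \<open>insert j J\<close> is an update
      at \<open>j\<close> alone.\<close>
    have "?m(j := p j) = ?m" "?m(j := q j) = (\<lambda>i. if i \<in> insert j J then q i else p i)"
      using insert.hyps by auto
    then have "(copairing T ?m, copairing T (\<lambda>i. if i \<in> insert j J then q i else p i)) \<in> eqv apex T"
      using copairing_update[OF T, of ?m j "p j" "q j"] insert.prems p q eq by auto
    then show ?case
      using insert.IH insert.prems coend_rel_trans unfolding eqv_def by blast
  qed
  from this[OF finite_index subset_refl]
  have "(copairing T p, copairing T (\<lambda>i. if i \<in> I then q i else p i)) \<in> eqv apex T" .
  \<comment> \<open>These two families may differ outside \<open>I\<close>; on \<open>I\<close> they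
    coincide, so reflexivity of refinement compares them.\<close>
  moreover have "(copairing T (\<lambda>i. if i \<in> I then q i else p i), copairing T q) \<in> eqv apex T"
    by (rule copairing_refines[OF T]) (use q refines_refl[OF T q] in auto)
  ultimately show ?thesis using coend_rel_trans unfolding eqv_def by blast
qed

text \<open>The legs of \<open>q\<close> refine those of the copairing built from them, hence
  \<open>q\<close> refines that copairing. This is the uniqueness half of the universal
  property.\<close>

lemma copairing_legs:
  assumes T: "is_ob T" and q: "q \<in> reps apex T"
  shows "(q, copairing T (leg T q)) \<in> eqv apex T"
proof -
  note l = leg_rep[OF T q]
  show ?thesis
    by (rule refines_eqv[OF T q copairing(1)[OF T l] refines_if_legs_refine[OF T q copairing(1)[OF T l]
            copairing(2)[OF T l]]])
qed

section \<open>The universal property in the category of optics\<close>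

lemma is_coproduct_apex:
  "is_coproduct (optic B L R) I summand apex
     (\<lambda>i. (summand i, apex, cls (summand i) apex (\<iota> i, u i, v i)))"
  unfolding is_coproduct_def
proof (intro conjI ballI allI impI)
  show "apex \<in> Ob (optic B L R)" using is_ob_apex by (simp add: is_ob_def)
  show "(summand i, apex, cls (summand i) apex (\<iota> i, u i, v i)) \<in> hom (optic B L R) (summand i) apex"
    if "i \<in> I" for i
    unfolding hom_optic_iff using is_ob_summand[OF that] is_ob_apex inclusion_rep[OF that] by blast
next
  fix T F
  assume "T \<in> Ob (optic B L R)" and "\<forall>i\<in>I. F i \<in> hom (optic B L R) (summand i) T"
  then have T: "is_ob T" and F: "\<forall>i\<in>I. \<exists>p. p \<in> reps (summand i) T \<and> F i = (summand i, T, cls (summand i) T p)"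
    unfolding hom_optic_iff is_ob_def by blast+
  obtain p where p: "\<And>i. i \<in> I \<Longrightarrow> p i \<in> reps (summand i) T"
    and Fp: "\<And>i. i \<in> I \<Longrightarrow> F i = (summand i, T, cls (summand i) T (p i))"
    using F unfolding bchoice_iff by blast
  \<comment> \<open>The commuting triangles are translated into the coend relation between legs and
    given representatives.\<close>
  have comp: "(apex, T, cls apex T q) \<cdot>\<^bsub>optic B L R\<^esub> (summand i, apex, cls (summand i) apex (\<iota> i, u i, v i)) = F i
      \<longleftrightarrow> (leg T q i, p i) \<in> eqv (summand i) T" if "i \<in> I" "q \<in> reps apex T" for q i
    using optic_comp_class[OF is_ob_summand[OF that(1)] is_ob_apex T inclusion_rep[OF that(1)] that(2)]
    by (simp add: Fp[OF that(1)] cls_eq_iff)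
  let ?q = "copairing T p"
  note q = copairing(1)[OF T p]
  show "\<exists>!h. h \<in> hom (optic B L R) apex T \<and>
      (\<forall>i\<in>I. h \<cdot>\<^bsub>optic B L R\<^esub> (summand i, apex, cls (summand i) apex (\<iota> i, u i, v i)) = F i)"
  proof (rule ex1I[of _ "(apex, T, cls apex T ?q)"], intro conjI ballI)
    show "(apex, T, cls apex T ?q) \<in> hom (optic B L R) apex T"
      unfolding hom_optic_iff using is_ob_apex T q by blast
    show "(apex, T, cls apex T ?q) \<cdot>\<^bsub>optic B L R\<^esub> (summand i, apex, cls (summand i) apex (\<iota> i, u i, v i)) = F i"
      if "i \<in> I" for i
      by (rule iffD2[OF comp[OF that q] refines_eqv[OF T leg_rep[OF T q that] p[OF that] copairing(3)[OF T p that]]])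
  next
    fix h assume h: "h \<in> hom (optic B L R) apex T \<and>
      (\<forall>i\<in>I. h \<cdot>\<^bsub>optic B L R\<^esub> (summand i, apex, cls (summand i) apex (\<iota> i, u i, v i)) = F i)"
    then obtain q' where q': "q' \<in> reps apex T" "h = (apex, T, cls apex T q')"
      unfolding hom_optic_iff by blast
    have eq: "(leg T q' i, p i) \<in> eqv (summand i) T" if "i \<in> I" for i
      using h comp[OF that q'(1)] that unfolding q'(2) by blast
    \<comment> \<open>Any mediating \<open>q'\<close> is equivalent to the copairing of its legs,
      and these legs are equivalent to the \<open>p i\<close>, possibly through a different zigzag
      for each \<open>i\<close>.\<close>
    have "(copairing T (leg T q'), ?q) \<in> eqv apex T"
      by (rule copairing_cong[OF T leg_rep[OF T q'(1)] eq])
    then have "(q', ?q) \<in> eqv apex T"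
      using copairing_legs[OF T q'(1)] coend_rel_trans unfolding eqv_def by blast
    then show "h = (apex, T, cls apex T ?q)"
      unfolding q'(2) by (simp add: cls_eq_iff)
  qed
qed

end

section \<open>Coproduct data for a finite family of objects\<close>

theorem proposition3:
  fixes B :: "('o, 'f, 't) bicat"
    and L :: "('o, 'f, 't, 'x, 'm) icat"
    and R :: "('o, 'f, 't, 'y, 'n) icat"
  assumes "bicategory B"
    and "has_finite_bicoproducts B"
    and "indexed_category B L"
    and "indexed_category B R"
    and "coproducts_to_products B L"
    and "coproducts_to_products B R"
  shows "has_finite_coproducts (optic B L R)"
  unfolding has_finite_coproducts_def
proof (intro allI impI)
  fix I :: "nat set" and S
  assume I: "finite I" and S: "\<forall>i\<in>I. S i \<in> Ob (optic B L R)"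
  interpret optic_setting B L R using assms(3,4) by (rule optic_setting.intro)
  define A where "A i = fst (S i)" for i
  define X where "X i = fst (snd (S i))" for i
  define X' where "X' i = snd (snd (S i))" for i
  \<comment> \<open>An equation of functions, so that the summand family of the locale is literally
    \<open>S\<close>.\<close>
  have S_eq: "S = (\<lambda>i. (A i, X i, X' i))" by (simp add: A_def X_def X'_def)
  have A: "A i \<in> Ob0 B" and X: "X i \<in> Ob (Fib L (A i))" and X': "X' i \<in> Ob (Fib R (A i))" if "i \<in> I" for i
    using S that is_ob_iff[of "A i" "X i" "X' i"] by (auto simp: S_eq is_ob_def)
  obtain c \<iota> where c: "is_bicoproduct B I A c \<iota>"
    using assms(2) I A unfolding has_finite_bicoproducts_def by blast
  have eL: "is_equivalence (Fib L c) (prod_cat I (\<lambda>i. Fib L (A i))) (restrict_along L I \<iota>)"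
    and eR: "is_equivalence (Fib R c) (prod_cat I (\<lambda>i. Fib R (A i))) (restrict_along R I \<iota>)"
    using assms(5,6) I c unfolding coproducts_to_products_def by blast+
  obtain W w where W: "W \<in> Ob (Fib L c)"
    and w: "\<And>i. i \<in> I \<Longrightarrow> w i \<in> hom (Fib L (A i)) (fob (restrict_along L I \<iota>) W i) (X i)"
    and w_iso: "\<And>i. i \<in> I \<Longrightarrow> is_iso (Fib L (A i)) (w i)"
    using prod_equivalence_essentially_surjective[OF eL X] by blast
  obtain W' v where W': "W' \<in> Ob (Fib R c)"
    and v: "\<And>i. i \<in> I \<Longrightarrow> v i \<in> hom (Fib R (A i)) (fob (restrict_along R I \<iota>) W' i) (X' i)"
    and v_iso: "\<And>i. i \<in> I \<Longrightarrow> is_iso (Fib R (A i)) (v i)"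
    using prod_equivalence_essentially_surjective[OF eR X'] by blast
  \<comment> \<open>Essential surjectivity yields isomorphisms out of the restricted objects. The
    left part of an optic has to end there, so \<open>w\<close> is inverted; the right part starts
    there, so \<open>v\<close> is kept.\<close>
  interpret optic_cocone B L R I A X X' c \<iota> W W' "\<lambda>i. inv_ar (Fib L (A i)) (w i)" v
  proof
    fix i assume i: "i \<in> I"
    have w: "w i \<in> hom (Fib L (A i)) (fob (Pull L (\<iota> i)) W) (X i)"
      using w[OF i] i by (simp add: restrict_along_def)
    show "inv_ar (Fib L (A i)) (w i) \<in> hom (Fib L (A i)) (X i) (fob (Pull L (\<iota> i)) W)"
      by (rule category.inv_ar_props(1)[OF L.fib[OF A[OF i]] w w_iso[OF i]])
    show "is_iso (Fib L (A i)) (inv_ar (Fib L (A i)) (w i))"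
      by (rule category.is_iso_inv_ar[OF L.fib[OF A[OF i]] w w_iso[OF i]])
    show "v i \<in> hom (Fib R (A i)) (fob (Pull R (\<iota> i)) W') (X' i)"
      using v[OF i] i by (simp add: restrict_along_def)
  qed (use I c eL eR W W' v_iso in auto)
  show "\<exists>c \<iota>. is_coproduct (optic B L R) I S c \<iota>"
    using is_coproduct_apex unfolding S_eq by blast
qed

end
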